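(* Let $R$ be a commutative Bézout domain (with $1\neq 0$) of stable range $1.5$, let $m\in R$ be a nonzero nonunit, and let $R_m=R/mR$. Let $n\ge 2$ and let $\Phi=\mathrm{diag}(\varphi_1,\varphi_2,\dots,\varphi_n)\in R_m^{n\times n}$, where $\varphi_1\mid\varphi_2\mid\cdots\mid\varphi_n\neq 0$ in $R_m$. Then the Zelisko group $\mathbf{G}_\Phi$ consists of all invertible matrices of the form $$\begin{bmatrix} h_{11} & h_{12} & \cdots & h_{1,n-1} & h_{1n}\\ \widetilde{\frac{\varphi_2}{\varphi_1}}\,h_{21} & h_{22} & \cdots & h_{2,n-1} & h_{2n}\\ \cdots & \cdots & \cdots & \cdots & \cdots\\ \widetilde{\frac{\varphi_n}{\varphi_1}}\,h_{n1} & \widetilde{\frac{\varphi_n}{\varphi_2}}\,h_{n2} & \cdots & \widetilde{\frac{\varphi_n}{\varphi_{n-1}}}\,h_{n,n-1} & h_{nn}\end{bmatrix}$$ with $h_{ij}\in R_m$, where for $1\le l<k\le n$ the element $\widetilde{\frac{\varphi_k}{\varphi_l}}\in R_m$ is the minimal generating solution of the linear equation $\varphi_k=\varphi_l x$ in $R_m$.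
   Context: $(a_1,\dots,a_k)$ denotes the greatest common divisor (determined up to a unit). A commutative ring $R$ has stable range $1.5$ if for all $a,b\in R$ and $c\in R\setminus\{0\}$ with $(a,b,c)=1$ there exists $r\in R$ such that $(a+br,c)=1$. In a commutative ring, $a\mid b$ means $b=ac$ for some $c$ in the ring. The Zelisko group of $\Phi$ is $\mathbf{G}_\Phi=\{H\in \mathrm{GL}_n(R_m)\mid \exists S\in \mathrm{GL}_n(R_m)\text{ such that } H\Phi=\Phi S\}$. A generating solution of a solvable equation $b=ax$ in $R_m$ is a solution which divides (in $R_m$) every solution of the equation; every solvable linear equation in $R_m$ has a generating solution. An order $\le$ on the set $R_m$ is fixed, namely a total order in which the set of generating solutions of every solvable linear equation has a least element (for instance a well-ordering); $\widetilde{\frac{b}{a}}$ denotes the least generating solution, with respect to this order, of a solvable equation $b=ax$. *)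

theory Defs
  imports "HOL-Algebra.QuotRing" "HOL-Algebra.Divisibility" "Jordan_Normal_Form.Matrix"
begin

definition bezout_domain :: "('a, 'b) ring_scheme \<Rightarrow> bool"
  where "bezout_domain R \<longleftrightarrow> domain R \<and>
    (\<forall>A. finite A \<and> A \<subseteq> carrier R \<longrightarrow> principalideal (Idl\<^bsub>R\<^esub> A) R)"

text \<open>
  The library's binary \<^const>\<open>isgcd\<close>, for an arbitrary set of elements. As gcds are determined only
  up to a unit, an equation \<open>(a, b, \<dots>) = d\<close> means that \<open>d\<close> is a gcd of \<open>a, b, \<dots>\<close>.
\<close>
definition is_gcd :: "('a, 'b) monoid_scheme \<Rightarrow> 'a \<Rightarrow> 'a set \<Rightarrow> bool"
  where "is_gcd G d A \<longleftrightarrow> d \<in> carrier G \<and> (\<forall>a\<in>A. d divides\<^bsub>G\<^esub> a) \<and>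
    (\<forall>y\<in>carrier G. (\<forall>a\<in>A. y divides\<^bsub>G\<^esub> a) \<longrightarrow> y divides\<^bsub>G\<^esub> d)"

definition stable_range_one_half :: "('a, 'b) ring_scheme \<Rightarrow> bool"
    \<comment> \<open>stable range 1.5\<close>
  where "stable_range_one_half R \<longleftrightarrow>
    (\<forall>a\<in>carrier R. \<forall>b\<in>carrier R. \<forall>c\<in>carrier R - {\<zero>\<^bsub>R\<^esub>}.
      is_gcd R \<one>\<^bsub>R\<^esub> {a, b, c} \<longrightarrow>
      (\<exists>r\<in>carrier R. is_gcd R \<one>\<^bsub>R\<^esub> {a \<oplus>\<^bsub>R\<^esub> b \<otimes>\<^bsub>R\<^esub> r, c}))"

definition quot_mod :: "('a, 'b) ring_scheme \<Rightarrow> 'a \<Rightarrow> 'a set ring"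
  where "quot_mod R m = R Quot (PIdl\<^bsub>R\<^esub> m)"

text \<open>
  The type \<^typ>\<open>'a mat\<close> serves only as a container, indexed from \<open>0\<close>. The arithmetic that comes with it
  belongs to the type class of the entries, so the product is defined anew from the operations of \<open>Q\<close>.
\<close>
definition mat_monoid :: "('a, 'b) ring_scheme \<Rightarrow> nat \<Rightarrow> 'a mat monoid"
  where "mat_monoid Q n =
    \<lparr>carrier = {A \<in> carrier_mat n n. \<forall>i<n. \<forall>j<n. A $$ (i, j) \<in> carrier Q},
     monoid.mult = (\<lambda>A B. mat n n (\<lambda>(i, j). \<Oplus>\<^bsub>Q\<^esub>k\<in>{..<n}. A $$ (i, k) \<otimes>\<^bsub>Q\<^esub> B $$ (k, j))),
     one = mat n n (\<lambda>(i, j). if i = j then \<one>\<^bsub>Q\<^esub> else \<zero>\<^bsub>Q\<^esub>)\<rparr>"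

definition GL :: "nat \<Rightarrow> ('a, 'b) ring_scheme \<Rightarrow> 'a mat set"
  where "GL n Q = Units (mat_monoid Q n)"

definition diagonal_matrix :: "('a, 'b) ring_scheme \<Rightarrow> nat \<Rightarrow> (nat \<Rightarrow> 'a) \<Rightarrow> 'a mat"
  where "diagonal_matrix Q n \<phi> = mat n n (\<lambda>(i, j). if i = j then \<phi> i else \<zero>\<^bsub>Q\<^esub>)"

definition zelisko_group :: "('a, 'b) ring_scheme \<Rightarrow> nat \<Rightarrow> 'a mat \<Rightarrow> 'a mat set"
  where "zelisko_group Q n \<Phi> =
    {H \<in> GL n Q. \<exists>S\<in>GL n Q. H \<otimes>\<^bsub>mat_monoid Q n\<^esub> \<Phi> = \<Phi> \<otimes>\<^bsub>mat_monoid Q n\<^esub> S}"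

text \<open>The set of generating solutions of the equation \<open>b = a x\<close>.\<close>
definition generating_solutions :: "('a, 'b) ring_scheme \<Rightarrow> 'a \<Rightarrow> 'a \<Rightarrow> 'a set"
  where "generating_solutions Q b a =
    {x \<in> carrier Q. b = a \<otimes>\<^bsub>Q\<^esub> x \<and>
      (\<forall>y\<in>carrier Q. b = a \<otimes>\<^bsub>Q\<^esub> y \<longrightarrow> x divides\<^bsub>Q\<^esub> y)}"

definition is_least :: "'a rel \<Rightarrow> 'a set \<Rightarrow> 'a \<Rightarrow> bool"
  where "is_least ord A x \<longleftrightarrow> x \<in> A \<and> (\<forall>y\<in>A. (x, y) \<in> ord)"

text \<open>
  The orders with respect to which minimal generating solutions are taken. That every solvable
  equation has a generating solution is not part of the definition.
\<close>
definition admissible_order :: "('a, 'b) ring_scheme \<Rightarrow> 'a rel \<Rightarrow> bool"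
  where "admissible_order Q ord \<longleftrightarrow> linear_order_on (carrier Q) ord \<and>
    (\<forall>a\<in>carrier Q. \<forall>b\<in>carrier Q. a divides\<^bsub>Q\<^esub> b \<longrightarrow> generating_solutions Q b a \<noteq> {} \<longrightarrow>
      (\<exists>x. is_least ord (generating_solutions Q b a) x))"

definition min_generating_solution :: "('a, 'b) ring_scheme \<Rightarrow> 'a rel \<Rightarrow> 'a \<Rightarrow> 'a \<Rightarrow> 'a"
  where "min_generating_solution Q ord b a = (THE x. is_least ord (generating_solutions Q b a) x)"

end

theory Submission
  imports Defs
begin

text \<open>
  Write \<open>Q = R/mR\<close>. Comparing entries, \<open>H \<Phi> = \<Phi> S\<close> says \<open>h\<^sub>i\<^sub>j \<phi>\<^sub>j = \<phi>\<^sub>i s\<^sub>i\<^sub>j\<close>, so some matrix \<open>S\<close>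
  with this property exists iff \<open>\<phi>\<^sub>i\<close> divides \<open>h\<^sub>i\<^sub>j \<phi>\<^sub>j\<close> for all \<open>i, j\<close>. On and above the diagonal this
  is automatic because \<open>\<phi>\<^sub>i\<close> divides \<open>\<phi>\<^sub>j\<close>. Below the diagonal it is equivalent to \<open>t\<close> dividing
  \<open>h\<^sub>i\<^sub>j\<close>, for any generating solution \<open>t\<close> of \<open>\<phi>\<^sub>i = \<phi>\<^sub>j x\<close>: a generating solution divides the
  difference of any two solutions, hence the whole annihilator of \<open>\<phi>\<^sub>j\<close>
  (\<open>generating_solution_divides_iff\<close>). This is the shape of the matrices in the theorem, except that
  the Zelisko group asks for an invertible \<open>S\<close>; as \<open>\<Phi>\<close> may have zero divisors on its diagonal, \<open>H\<close>
  does not determine \<open>S\<close>, and not every choice of \<open>S\<close> is invertible.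

  An invertible \<open>S\<close> is found by elimination (\<open>invertible_intertwiner_in_zelisko_group\<close>). The quotient
  \<open>Q\<close> has stable range one, because a unimodular pair in \<open>Q\<close> lifts to a unimodular triple with third
  entry \<open>m\<close> in \<open>R\<close>. The last row of an invertible \<open>H\<close> is unimodular, so adding multiples of the
  other columns to the last one turns the corner entry into a unit; then the last row and the last
  column can be cleared. Each of these operations is multiplication by a matrix of the form
  \<open>I + x y\<^sup>T\<close> which lies in the Zelisko group by an explicit computation: adding to a later
  column, or to an earlier row, is always allowed, and the multiples needed to clear the last row are
  exactly of the allowed kind because of the divisibility condition on \<open>H\<close>. Induction on the size
  reduces \<open>H\<close> to the identity, so \<open>H\<close> is a product of elements of the Zelisko group.

  That generating solutions exist at all (\<open>generating_solutions_nonempty\<close>) is again a consequence of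
  stable range one: the solutions form a coset \<open>x\<^sub>0 + k Q\<close>, and this coset contains a generator of
  the ideal spanned by \<open>x\<^sub>0\<close> and \<open>k\<close>.
\<close>

section \<open>Stable range one\<close>

definition stable_range_one :: "('a, 'b) ring_scheme \<Rightarrow> bool"
  where "stable_range_one Q \<longleftrightarrow>
    (\<forall>a\<in>carrier Q. \<forall>b\<in>carrier Q. \<forall>x\<in>carrier Q. \<forall>y\<in>carrier Q.
      a \<otimes>\<^bsub>Q\<^esub> x \<oplus>\<^bsub>Q\<^esub> b \<otimes>\<^bsub>Q\<^esub> y = \<one>\<^bsub>Q\<^esub> \<longrightarrow>
      (\<exists>r\<in>carrier Q. a \<oplus>\<^bsub>Q\<^esub> b \<otimes>\<^bsub>Q\<^esub> r \<in> Units Q))"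

lemma (in cring) stable_range_oneD:
  assumes "stable_range_one R" "a \<in> carrier R" "b \<in> carrier R" "x \<in> carrier R" "y \<in> carrier R"
    and "a \<otimes> x \<oplus> b \<otimes> y = \<one>"
  obtains r where "r \<in> carrier R" "a \<oplus> b \<otimes> r \<in> Units R"
  using assms unfolding stable_range_one_def by blast

text \<open>
  The hypotheses say that \<open>g\<close> generates the ideal of \<open>a = g p\<close> and \<open>b = g q\<close>; the conclusion is that
  the coset \<open>a + b R\<close> already contains a generator. As \<open>g\<close> may be a zero divisor, \<open>p\<close> and \<open>q\<close> need
  not be unimodular. But the defect \<open>c = 1 - (p \<alpha> + q \<beta>)\<close> annihilates \<open>g\<close>, so it may be added to a
  multiple of \<open>q\<close> without changing products with \<open>g\<close>, and stable range one applies to \<open>p\<close> and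
  \<open>q \<beta> + c\<close>.
\<close>
lemma (in cring) stable_range_one_coset_generator:
  assumes sr: "stable_range_one R"
    and [simp]: "p \<in> carrier R" "q \<in> carrier R" "g \<in> carrier R"
      "\<alpha> \<in> carrier R" "\<beta> \<in> carrier R"
    and g: "g = g \<otimes> p \<otimes> \<alpha> \<oplus> g \<otimes> q \<otimes> \<beta>"
  obtains r u where "r \<in> carrier R" "u \<in> Units R"
    "g \<otimes> p \<oplus> g \<otimes> q \<otimes> r = g \<otimes> u"
proof -
  define c where "c = \<one> \<ominus> (p \<otimes> \<alpha> \<oplus> q \<otimes> \<beta>)"
  have c[simp]: "c \<in> carrier R" by (simp add: c_def)
  have "g \<otimes> c = g \<ominus> (g \<otimes> p \<otimes> \<alpha> \<oplus> g \<otimes> q \<otimes> \<beta>)"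
    unfolding c_def using assms(2-6) by algebra
  also have "\<dots> = g \<ominus> g" using g by metis
  finally have gc: "g \<otimes> c = \<zero>" by (simp add: a_minus_def r_neg)
  have "p \<otimes> \<alpha> \<oplus> (q \<otimes> \<beta> \<oplus> c) \<otimes> \<one> = \<one>"
    unfolding c_def using assms(2-6) by algebra
  then obtain r where r[simp]: "r \<in> carrier R" and u: "p \<oplus> (q \<otimes> \<beta> \<oplus> c) \<otimes> r \<in> Units R"
    using stable_range_oneD[OF sr, of p "q \<otimes> \<beta> \<oplus> c" \<alpha> \<one>] by auto
  have "g \<otimes> (p \<oplus> (q \<otimes> \<beta> \<oplus> c) \<otimes> r) = g \<otimes> p \<oplus> g \<otimes> q \<otimes> (\<beta> \<otimes> r) \<oplus> g \<otimes> c \<otimes> r"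
    using c r assms(2-6) by algebra
  also have "\<dots> = g \<otimes> p \<oplus> g \<otimes> q \<otimes> (\<beta> \<otimes> r)" by (simp add: gc)
  finally show thesis by (intro that[of "\<beta> \<otimes> r", OF _ u]) auto
qed

section \<open>Generating solutions\<close>

text \<open>
  Two-generated ideals are principal, spelt out with witnesses: in this form the property passes to
  homomorphic images by applying the homomorphism to every witness.
\<close>
definition bezout_pairs :: "('a, 'b) ring_scheme \<Rightarrow> bool"
  where "bezout_pairs Q \<longleftrightarrow>
    (\<forall>a\<in>carrier Q. \<forall>b\<in>carrier Q. \<exists>g\<in>carrier Q. \<exists>p\<in>carrier Q. \<exists>q\<in>carrier Q.
      \<exists>\<alpha>\<in>carrier Q. \<exists>\<beta>\<in>carrier Q. a = g \<otimes>\<^bsub>Q\<^esub> p \<and> b = g \<otimes>\<^bsub>Q\<^esub> q \<and>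
        g = a \<otimes>\<^bsub>Q\<^esub> \<alpha> \<oplus>\<^bsub>Q\<^esub> b \<otimes>\<^bsub>Q\<^esub> \<beta>)"

lemma bezout_pairsE:
  assumes "bezout_pairs Q" "a \<in> carrier Q" "b \<in> carrier Q"
  obtains g p q \<alpha> \<beta> where "g \<in> carrier Q" "p \<in> carrier Q" "q \<in> carrier Q"
    "\<alpha> \<in> carrier Q" "\<beta> \<in> carrier Q" "a = g \<otimes>\<^bsub>Q\<^esub> p" "b = g \<otimes>\<^bsub>Q\<^esub> q"
    "g = a \<otimes>\<^bsub>Q\<^esub> \<alpha> \<oplus>\<^bsub>Q\<^esub> b \<otimes>\<^bsub>Q\<^esub> \<beta>"
proof -
  have "\<exists>g\<in>carrier Q. \<exists>p\<in>carrier Q. \<exists>q\<in>carrier Q.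
      \<exists>\<alpha>\<in>carrier Q. \<exists>\<beta>\<in>carrier Q. a = g \<otimes>\<^bsub>Q\<^esub> p \<and> b = g \<otimes>\<^bsub>Q\<^esub> q \<and>
        g = a \<otimes>\<^bsub>Q\<^esub> \<alpha> \<oplus>\<^bsub>Q\<^esub> b \<otimes>\<^bsub>Q\<^esub> \<beta>"
    using assms unfolding bezout_pairs_def by blast
  then show thesis by (elim bexE conjE) (rule that)
qed

definition principal_annihilators :: "('a, 'b) ring_scheme \<Rightarrow> bool"
  where "principal_annihilators Q \<longleftrightarrow>
    (\<forall>a\<in>carrier Q. \<exists>k\<in>carrier Q. \<forall>x\<in>carrier Q.
      a \<otimes>\<^bsub>Q\<^esub> x = \<zero>\<^bsub>Q\<^esub> \<longleftrightarrow> k divides\<^bsub>Q\<^esub> x)"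

text \<open>
  The solutions of \<open>b = a x\<close> form the coset \<open>x\<^sub>0 + k R\<close>, where \<open>k\<close> generates the annihilator of \<open>a\<close>.
  All of them lie in the ideal generated by \<open>x\<^sub>0\<close> and \<open>k\<close>, so an element of the coset which generates
  this ideal divides every solution.
\<close>
lemma (in cring) generating_solutions_nonempty:
  assumes sr: "stable_range_one R" and bez: "bezout_pairs R" and ann: "principal_annihilators R"
    and a[simp]: "a \<in> carrier R" and ab: "a divides b"
  shows "generating_solutions R b a \<noteq> {}"
proof -
  from ab obtain x0 where x0[simp]: "x0 \<in> carrier R" and b: "b = a \<otimes> x0"
    by (auto simp: factor_def)
  obtain k where k[simp]: "k \<in> carrier R"
    and kann: "\<forall>x\<in>carrier R. a \<otimes> x = \<zero> \<longleftrightarrow> k divides x"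
    using bspec[OF ann[unfolded principal_annihilators_def] a] by (elim bexE) (rule that)
  have ak: "a \<otimes> k = \<zero>" using kann by simp
  obtain g p q \<alpha> \<beta> where c[simp]: "g \<in> carrier R" "p \<in> carrier R" "q \<in> carrier R"
    "\<alpha> \<in> carrier R" "\<beta> \<in> carrier R" and x0g: "x0 = g \<otimes> p" and kg: "k = g \<otimes> q"
    and gx: "g = x0 \<otimes> \<alpha> \<oplus> k \<otimes> \<beta>"
    by (rule bezout_pairsE[OF bez x0 k])
  obtain r u where r[simp]: "r \<in> carrier R" and u: "u \<in> Units R"
    and x: "g \<otimes> p \<oplus> g \<otimes> q \<otimes> r = g \<otimes> u"
    using stable_range_one_coset_generator[OF sr c(2,3,1,4,5) gx[unfolded x0g kg]] by blast
  have [simp]: "u \<in> carrier R" "inv u \<in> carrier R" using u by auto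
  have xk: "g \<otimes> u = x0 \<oplus> k \<otimes> r" using x x0g kg by simp
  have sol: "a \<otimes> (g \<otimes> u) = b"
    unfolding xk b by (simp add: r_distr m_assoc[symmetric] ak)
  have "g \<otimes> u divides y" if y[simp]: "y \<in> carrier R" and yb: "b = a \<otimes> y" for y
  proof -
    have "a \<otimes> (y \<ominus> x0) = a \<otimes> y \<ominus> a \<otimes> x0" using y a x0 by algebra
    also have "\<dots> = \<zero>" using yb b by (simp add: a_minus_def r_neg)
    finally have "k divides (y \<ominus> x0)" using kann by simp
    then obtain z where z[simp]: "z \<in> carrier R" and kz: "y \<ominus> x0 = k \<otimes> z"
      by (auto simp: factor_def)
    have "y = x0 \<oplus> (y \<ominus> x0)" using y x0 by algebra
    also have "\<dots> = g \<otimes> p \<oplus> g \<otimes> q \<otimes> z" unfolding kz by (simp only: x0g kg)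
    also have "\<dots> = g \<otimes> (u \<otimes> inv u) \<otimes> (p \<oplus> q \<otimes> z)"
      using c z u by (simp add: r_distr m_assoc)
    also have "\<dots> = g \<otimes> u \<otimes> (inv u \<otimes> (p \<oplus> q \<otimes> z))"
      by (simp add: m_assoc)
    finally show ?thesis by (intro dividesI[of "inv u \<otimes> (p \<oplus> q \<otimes> z)"]) auto
  qed
  then have "g \<otimes> u \<in> generating_solutions R b a"
    using sol by (auto simp: generating_solutions_def)
  then show ?thesis by blast
qed

text \<open>
  This is why the choice among the generating solutions is immaterial: each of them cuts out the same
  set of multiples, namely the elements \<open>h\<close> for which \<open>h a\<close> is divisible by \<open>b\<close>.
\<close>
lemma (in cring) generating_solution_divides_iff:
  assumes t: "t \<in> generating_solutions R b a" and a[simp]: "a \<in> carrier R"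
    and h[simp]: "h \<in> carrier R"
  shows "t divides h \<longleftrightarrow> b divides h \<otimes> a"
proof
  have tc[simp]: "t \<in> carrier R" and b: "b = a \<otimes> t"
    and gen: "\<And>y. y \<in> carrier R \<Longrightarrow> b = a \<otimes> y \<Longrightarrow> t divides y"
    using t by (auto simp: generating_solutions_def)
  {
    assume "t divides h"
    then obtain z where "z \<in> carrier R" "h = t \<otimes> z" by (auto simp: factor_def)
    then show "b divides h \<otimes> a"
      by (intro dividesI[of z]) (auto simp: b m_ac)
  }
  {
    assume "b divides h \<otimes> a"
    then obtain s where s[simp]: "s \<in> carrier R" and hs: "h \<otimes> a = b \<otimes> s"
      by (auto simp: factor_def)
    \<comment> \<open>\<open>h - t s\<close> annihilates \<open>a\<close>, so adding it to \<open>t\<close> gives another solution.\<close>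
    have "a \<otimes> (t \<oplus> (h \<ominus> t \<otimes> s)) = b \<oplus> (h \<otimes> a \<ominus> b \<otimes> s)"
      unfolding b using a tc h s by algebra
    also have "\<dots> = b" using hs by (simp add: a_minus_def r_neg b)
    finally obtain z where z[simp]: "z \<in> carrier R" and "t \<oplus> (h \<ominus> t \<otimes> s) = t \<otimes> z"
      using gen[of "t \<oplus> (h \<ominus> t \<otimes> s)"] by (auto simp: factor_def)
    note tz = this(2)
    have "h = (t \<oplus> (h \<ominus> t \<otimes> s)) \<ominus> t \<oplus> t \<otimes> s" using tc h s by algebra
    also have "\<dots> = t \<otimes> z \<ominus> t \<oplus> t \<otimes> s" by (simp only: tz)
    also have "\<dots> = t \<otimes> (z \<ominus> \<one> \<oplus> s)" using tc z s by algebra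
    finally show "t divides h" by (intro dividesI[of "z \<ominus> \<one> \<oplus> s"]) auto
  }
qed

lemma min_generating_solution_in:
  assumes ord: "admissible_order Q ord" and "a \<in> carrier Q" "b \<in> carrier Q" "a divides\<^bsub>Q\<^esub> b"
    and "generating_solutions Q b a \<noteq> {}"
  shows "min_generating_solution Q ord b a \<in> generating_solutions Q b a"
proof -
  obtain x where x: "is_least ord (generating_solutions Q b a) x"
    using assms unfolding admissible_order_def by blast
  have "antisym ord"
    using ord by (auto simp: admissible_order_def linear_order_on_def partial_order_on_def)
  then have "y = x" if "is_least ord (generating_solutions Q b a) y" for y
    using x that by (auto simp: is_least_def dest: antisymD)
  then have "min_generating_solution Q ord b a = x"
    unfolding min_generating_solution_def using x by (intro the_equality)
  then show ?thesis using x by (simp add: is_least_def)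
qed

section \<open>Matrices over a commutative ring\<close>

abbreviation kronecker :: "('a, 'b) ring_scheme \<Rightarrow> nat \<Rightarrow> nat \<Rightarrow> 'a"
  where "kronecker Q i j \<equiv> (if i = j then \<one>\<^bsub>Q\<^esub> else \<zero>\<^bsub>Q\<^esub>)"

lemma mat_monoid_carrierI:
  assumes "dim_row A = n" "dim_col A = n"
    "\<And>i j. i < n \<Longrightarrow> j < n \<Longrightarrow> A $$ (i, j) \<in> carrier Q"
  shows "A \<in> carrier (mat_monoid Q n)"
  using assms by (auto simp: mat_monoid_def)

lemma mat_monoid_carrierD:
  assumes "A \<in> carrier (mat_monoid Q n)"
  shows "dim_row A = n" "dim_col A = n" "\<And>i j. i < n \<Longrightarrow> j < n \<Longrightarrow> A $$ (i, j) \<in> carrier Q"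
  using assms by (auto simp: mat_monoid_def)

lemma mat_monoid_mult_index:
  assumes "i < n" "j < n"
  shows "(A \<otimes>\<^bsub>mat_monoid Q n\<^esub> B) $$ (i, j) = (\<Oplus>\<^bsub>Q\<^esub>k\<in>{..<n}. A $$ (i, k) \<otimes>\<^bsub>Q\<^esub> B $$ (k, j))"
  using assms by (simp add: mat_monoid_def)

lemma mat_monoid_one_index:
  assumes "i < n" "j < n"
  shows "\<one>\<^bsub>mat_monoid Q n\<^esub> $$ (i, j) = kronecker Q i j"
  using assms by (simp add: mat_monoid_def)

lemma mat_monoid_eqI:
  assumes "A \<in> carrier (mat_monoid Q n)" "B \<in> carrier (mat_monoid Q n)"
    "\<And>i j. i < n \<Longrightarrow> j < n \<Longrightarrow> A $$ (i, j) = B $$ (i, j)"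
  shows "A = B"
  using assms mat_monoid_carrierD(1,2)[OF assms(1)] mat_monoid_carrierD(1,2)[OF assms(2)]
  by (intro eq_matI) simp_all

context cring
begin

lemma finsum_kronecker_left:
  assumes "k < n" "\<And>l. l < n \<Longrightarrow> f l \<in> carrier R"
  shows "(\<Oplus>l\<in>{..<n}. kronecker R k l \<otimes> f l) = f k"
proof -
  have "(\<Oplus>l\<in>{..<n}. kronecker R k l \<otimes> f l) = (\<Oplus>l\<in>{..<n}. if k = l then f l else \<zero>)"
    using assms by (intro finsum_cong') auto
  also have "\<dots> = f k" using assms by (intro finsum_singleton) auto
  finally show ?thesis .
qed

lemma finsum_kronecker_right:
  assumes "k < n" "\<And>l. l < n \<Longrightarrow> f l \<in> carrier R"
  shows "(\<Oplus>l\<in>{..<n}. f l \<otimes> kronecker R l k) = f k"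
proof -
  have "(\<Oplus>l\<in>{..<n}. f l \<otimes> kronecker R l k) = (\<Oplus>l\<in>{..<n}. kronecker R k l \<otimes> f l)"
    using assms by (intro finsum_cong') auto
  then show ?thesis using finsum_kronecker_left[OF assms] by simp
qed

lemma mat_monoid_mult_closed:
  assumes "A \<in> carrier (mat_monoid R n)" "B \<in> carrier (mat_monoid R n)"
  shows "A \<otimes>\<^bsub>mat_monoid R n\<^esub> B \<in> carrier (mat_monoid R n)"
  using assms by (auto simp: mat_monoid_def intro!: finsum_closed)

lemma mat_monoid_one_closed: "\<one>\<^bsub>mat_monoid R n\<^esub> \<in> carrier (mat_monoid R n)"
  by (auto simp: mat_monoid_def)

lemma monoid_mat_monoid: "monoid (mat_monoid R n)"
proof (rule monoidI)
  fix A B C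
  assume *: "A \<in> carrier (mat_monoid R n)" "B \<in> carrier (mat_monoid R n)"
    "C \<in> carrier (mat_monoid R n)"
  note c[simp] = *[THEN mat_monoid_carrierD(3)]
  show "A \<otimes>\<^bsub>mat_monoid R n\<^esub> B \<otimes>\<^bsub>mat_monoid R n\<^esub> C =
    A \<otimes>\<^bsub>mat_monoid R n\<^esub> (B \<otimes>\<^bsub>mat_monoid R n\<^esub> C)"
  proof (rule mat_monoid_eqI)
    fix i j assume [simp]: "i < n" "j < n"
    have "(A \<otimes>\<^bsub>mat_monoid R n\<^esub> B \<otimes>\<^bsub>mat_monoid R n\<^esub> C) $$ (i, j) =
      (\<Oplus>k\<in>{..<n}. \<Oplus>l\<in>{..<n}. A $$ (i, l) \<otimes> B $$ (l, k) \<otimes> C $$ (k, j))"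
      by (auto simp: mat_monoid_mult_index finsum_ldistr intro!: finsum_cong' finsum_closed)
    also have "\<dots> = (\<Oplus>l\<in>{..<n}. \<Oplus>k\<in>{..<n}. A $$ (i, l) \<otimes> B $$ (l, k) \<otimes> C $$ (k, j))"
      by (intro finsum_finsum_swap) auto
    also have "\<dots> = (A \<otimes>\<^bsub>mat_monoid R n\<^esub> (B \<otimes>\<^bsub>mat_monoid R n\<^esub> C)) $$ (i, j)"
      by (auto simp: mat_monoid_mult_index finsum_rdistr m_assoc intro!: finsum_cong' finsum_closed)
    finally show "(A \<otimes>\<^bsub>mat_monoid R n\<^esub> B \<otimes>\<^bsub>mat_monoid R n\<^esub> C) $$ (i, j) =
      (A \<otimes>\<^bsub>mat_monoid R n\<^esub> (B \<otimes>\<^bsub>mat_monoid R n\<^esub> C)) $$ (i, j)" .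
  qed (auto intro: * mat_monoid_mult_closed)
next
  fix A assume *: "A \<in> carrier (mat_monoid R n)"
  note c[simp] = *[THEN mat_monoid_carrierD(3)]
  show "\<one>\<^bsub>mat_monoid R n\<^esub> \<otimes>\<^bsub>mat_monoid R n\<^esub> A = A"
  proof (rule mat_monoid_eqI)
    fix i j assume [simp]: "i < n" "j < n"
    have "(\<one>\<^bsub>mat_monoid R n\<^esub> \<otimes>\<^bsub>mat_monoid R n\<^esub> A) $$ (i, j) =
      (\<Oplus>l\<in>{..<n}. kronecker R i l \<otimes> A $$ (l, j))"
      by (auto simp: mat_monoid_mult_index mat_monoid_one_index intro!: finsum_cong')
    also have "\<dots> = A $$ (i, j)" by (rule finsum_kronecker_left) auto
    finally show "(\<one>\<^bsub>mat_monoid R n\<^esub> \<otimes>\<^bsub>mat_monoid R n\<^esub> A) $$ (i, j) = A $$ (i, j)" .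
  qed (auto intro: * mat_monoid_mult_closed mat_monoid_one_closed)
  show "A \<otimes>\<^bsub>mat_monoid R n\<^esub> \<one>\<^bsub>mat_monoid R n\<^esub> = A"
  proof (rule mat_monoid_eqI)
    fix i j assume [simp]: "i < n" "j < n"
    have "(A \<otimes>\<^bsub>mat_monoid R n\<^esub> \<one>\<^bsub>mat_monoid R n\<^esub>) $$ (i, j) =
      (\<Oplus>l\<in>{..<n}. A $$ (i, l) \<otimes> kronecker R l j)"
      by (auto simp: mat_monoid_mult_index mat_monoid_one_index intro!: finsum_cong')
    also have "\<dots> = A $$ (i, j)" by (rule finsum_kronecker_right) auto
    finally show "(A \<otimes>\<^bsub>mat_monoid R n\<^esub> \<one>\<^bsub>mat_monoid R n\<^esub>) $$ (i, j) = A $$ (i, j)" .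
  qed (auto intro: * mat_monoid_mult_closed mat_monoid_one_closed)
qed (auto intro: mat_monoid_mult_closed mat_monoid_one_closed)

end

section \<open>Rank-one updates of the identity\<close>

text \<open>
  The matrix \<open>I + x y\<^sup>T\<close>. Every operation of the elimination has this form: with \<open>y\<close> the \<open>k\<close>-th unit
  vector it changes only column \<open>k\<close> of the identity, and with \<open>x\<close> the \<open>k\<close>-th unit vector only row \<open>k\<close>.
\<close>
definition rank_one_update :: "('a, 'b) ring_scheme \<Rightarrow> nat \<Rightarrow> (nat \<Rightarrow> 'a) \<Rightarrow> (nat \<Rightarrow> 'a) \<Rightarrow> 'a mat"
  where "rank_one_update Q n x y = mat n n (\<lambda>(i, j). kronecker Q i j \<oplus>\<^bsub>Q\<^esub> x i \<otimes>\<^bsub>Q\<^esub> y j)"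

context cring
begin

lemma rank_one_update_index:
  assumes "i < n" "j < n"
  shows "rank_one_update R n x y $$ (i, j) = kronecker R i j \<oplus> x i \<otimes> y j"
  using assms by (simp add: rank_one_update_def)

lemma rank_one_update_closed:
  assumes "\<And>i. i < n \<Longrightarrow> x i \<in> carrier R" "\<And>i. i < n \<Longrightarrow> y i \<in> carrier R"
  shows "rank_one_update R n x y \<in> carrier (mat_monoid R n)"
  using assms by (intro mat_monoid_carrierI) (auto simp: rank_one_update_def)

lemma mult_rank_one_update_index:
  assumes A: "A \<in> carrier (mat_monoid R n)" and ij[simp]: "i < n" "j < n"
    and [simp]: "\<And>i. i < n \<Longrightarrow> x i \<in> carrier R" "\<And>i. i < n \<Longrightarrow> y i \<in> carrier R"
  shows "(A \<otimes>\<^bsub>mat_monoid R n\<^esub> rank_one_update R n x y) $$ (i, j) =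
    A $$ (i, j) \<oplus> (\<Oplus>l\<in>{..<n}. A $$ (i, l) \<otimes> x l) \<otimes> y j"
proof -
  note [simp] = mat_monoid_carrierD(3)[OF A]
  have "(A \<otimes>\<^bsub>mat_monoid R n\<^esub> rank_one_update R n x y) $$ (i, j) =
    (\<Oplus>l\<in>{..<n}. A $$ (i, l) \<otimes> kronecker R l j \<oplus> A $$ (i, l) \<otimes> x l \<otimes> y j)"
    by (auto simp: mat_monoid_mult_index rank_one_update_index r_distr m_assoc
        simp del: finsum_addf intro!: finsum_cong')
  also have "\<dots> = (\<Oplus>l\<in>{..<n}. A $$ (i, l) \<otimes> kronecker R l j) \<oplus>
      (\<Oplus>l\<in>{..<n}. A $$ (i, l) \<otimes> x l \<otimes> y j)"
    by (intro finsum_addf) auto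
  also have "(\<Oplus>l\<in>{..<n}. A $$ (i, l) \<otimes> kronecker R l j) = A $$ (i, j)"
    by (rule finsum_kronecker_right) auto
  also have "(\<Oplus>l\<in>{..<n}. A $$ (i, l) \<otimes> x l \<otimes> y j) = (\<Oplus>l\<in>{..<n}. A $$ (i, l) \<otimes> x l) \<otimes> y j"
    by (rule finsum_ldistr[symmetric]) auto
  finally show ?thesis .
qed

lemma rank_one_update_mult_index:
  assumes A: "A \<in> carrier (mat_monoid R n)" and ij[simp]: "i < n" "j < n"
    and [simp]: "\<And>i. i < n \<Longrightarrow> x i \<in> carrier R" "\<And>i. i < n \<Longrightarrow> y i \<in> carrier R"
  shows "(rank_one_update R n x y \<otimes>\<^bsub>mat_monoid R n\<^esub> A) $$ (i, j) =
    A $$ (i, j) \<oplus> x i \<otimes> (\<Oplus>l\<in>{..<n}. y l \<otimes> A $$ (l, j))"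
proof -
  note [simp] = mat_monoid_carrierD(3)[OF A]
  have "(rank_one_update R n x y \<otimes>\<^bsub>mat_monoid R n\<^esub> A) $$ (i, j) =
    (\<Oplus>l\<in>{..<n}. kronecker R i l \<otimes> A $$ (l, j) \<oplus> x i \<otimes> (y l \<otimes> A $$ (l, j)))"
    by (auto simp: mat_monoid_mult_index rank_one_update_index l_distr m_assoc
        simp del: finsum_addf intro!: finsum_cong')
  also have "\<dots> = (\<Oplus>l\<in>{..<n}. kronecker R i l \<otimes> A $$ (l, j)) \<oplus>
      (\<Oplus>l\<in>{..<n}. x i \<otimes> (y l \<otimes> A $$ (l, j)))"
    by (intro finsum_addf) auto
  also have "(\<Oplus>l\<in>{..<n}. kronecker R i l \<otimes> A $$ (l, j)) = A $$ (i, j)"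
    by (rule finsum_kronecker_left) auto
  also have "(\<Oplus>l\<in>{..<n}. x i \<otimes> (y l \<otimes> A $$ (l, j))) = x i \<otimes> (\<Oplus>l\<in>{..<n}. y l \<otimes> A $$ (l, j))"
    by (rule finsum_rdistr[symmetric]) auto
  finally show ?thesis .
qed

text \<open>
  For fixed \<open>x\<close> and \<open>y\<close> the matrices \<open>I + c x y\<^sup>T\<close> are closed under multiplication, since
  \<open>x y\<^sup>T x y\<^sup>T = s x y\<^sup>T\<close> with \<open>s = y\<^sup>T x\<close>.
\<close>
lemma rank_one_update_mult:
  assumes [simp]: "\<And>i. i < n \<Longrightarrow> x i \<in> carrier R" "\<And>i. i < n \<Longrightarrow> y i \<in> carrier R"
    "c \<in> carrier R" "d \<in> carrier R"
  defines "s \<equiv> \<Oplus>l\<in>{..<n}. y l \<otimes> x l"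
  shows "rank_one_update R n (\<lambda>i. c \<otimes> x i) y \<otimes>\<^bsub>mat_monoid R n\<^esub> rank_one_update R n (\<lambda>i. d \<otimes> x i) y =
    rank_one_update R n (\<lambda>i. (c \<oplus> d \<oplus> c \<otimes> d \<otimes> s) \<otimes> x i) y"
proof (rule mat_monoid_eqI)
  have s[simp]: "s \<in> carrier R" unfolding s_def by (auto intro!: finsum_closed)
  show "rank_one_update R n (\<lambda>i. c \<otimes> x i) y \<otimes>\<^bsub>mat_monoid R n\<^esub> rank_one_update R n (\<lambda>i. d \<otimes> x i) y
      \<in> carrier (mat_monoid R n)"
    "rank_one_update R n (\<lambda>i. (c \<oplus> d \<oplus> c \<otimes> d \<otimes> s) \<otimes> x i) y \<in> carrier (mat_monoid R n)"
    by (auto intro!: mat_monoid_mult_closed rank_one_update_closed)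
  fix i j assume ij[simp]: "i < n" "j < n"
  have "(\<Oplus>l\<in>{..<n}. y l \<otimes> rank_one_update R n (\<lambda>i. d \<otimes> x i) y $$ (l, j)) =
    (\<Oplus>l\<in>{..<n}. y l \<otimes> kronecker R l j \<oplus> (d \<otimes> y j) \<otimes> (y l \<otimes> x l))"
    by (auto simp: rank_one_update_index r_distr m_ac simp del: finsum_addf intro!: finsum_cong')
  also have "\<dots> = (\<Oplus>l\<in>{..<n}. y l \<otimes> kronecker R l j) \<oplus>
      (\<Oplus>l\<in>{..<n}. (d \<otimes> y j) \<otimes> (y l \<otimes> x l))"
    by (intro finsum_addf) auto
  also have "(\<Oplus>l\<in>{..<n}. y l \<otimes> kronecker R l j) = y j"
    by (rule finsum_kronecker_right) auto
  also have "(\<Oplus>l\<in>{..<n}. (d \<otimes> y j) \<otimes> (y l \<otimes> x l)) = (d \<otimes> y j) \<otimes> s"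
    unfolding s_def by (rule finsum_rdistr[symmetric]) auto
  finally have sum: "(\<Oplus>l\<in>{..<n}. y l \<otimes> rank_one_update R n (\<lambda>i. d \<otimes> x i) y $$ (l, j)) =
    y j \<oplus> d \<otimes> y j \<otimes> s" .
  have e[simp]: "x i \<in> carrier R" "y j \<in> carrier R" "kronecker R i j \<in> carrier R" by auto
  have "(rank_one_update R n (\<lambda>i. c \<otimes> x i) y \<otimes>\<^bsub>mat_monoid R n\<^esub> rank_one_update R n (\<lambda>i. d \<otimes> x i) y) $$ (i, j)
    = (kronecker R i j \<oplus> d \<otimes> x i \<otimes> y j) \<oplus> c \<otimes> x i \<otimes> (y j \<oplus> d \<otimes> y j \<otimes> s)"
    by (subst rank_one_update_mult_index) (auto simp only: sum rank_one_update_index ij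
        intro!: rank_one_update_closed m_closed assms)
  also have "\<dots> = kronecker R i j \<oplus> (c \<oplus> d \<oplus> c \<otimes> d \<otimes> s) \<otimes> x i \<otimes> y j"
    using e s assms(3,4) by algebra
  finally show "(rank_one_update R n (\<lambda>i. c \<otimes> x i) y \<otimes>\<^bsub>mat_monoid R n\<^esub> rank_one_update R n (\<lambda>i. d \<otimes> x i) y) $$ (i, j)
    = rank_one_update R n (\<lambda>i. (c \<oplus> d \<oplus> c \<otimes> d \<otimes> s) \<otimes> x i) y $$ (i, j)"
    by (simp add: rank_one_update_index)
qed

lemma rank_one_update_zero:
  assumes "\<And>i. i < n \<Longrightarrow> x i \<in> carrier R" "\<And>i. i < n \<Longrightarrow> y i \<in> carrier R"
  shows "rank_one_update R n (\<lambda>i. \<zero> \<otimes> x i) y = \<one>\<^bsub>mat_monoid R n\<^esub>"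
  using assms
  by (intro mat_monoid_eqI[where Q = R and n = n] mat_monoid_one_closed rank_one_update_closed)
     (auto simp: rank_one_update_index mat_monoid_one_index)

text \<open>
  By the multiplication rule, \<open>I + c x y\<^sup>T\<close> is a two-sided inverse as soon as \<open>1 + c + c s = 0\<close>, that is,
  \<open>c = - 1 / (1 + s)\<close>.
\<close>
lemma rank_one_update_GL:
  assumes x[simp]: "\<And>i. i < n \<Longrightarrow> x i \<in> carrier R" and y[simp]: "\<And>i. i < n \<Longrightarrow> y i \<in> carrier R"
    and u: "\<one> \<oplus> (\<Oplus>l\<in>{..<n}. y l \<otimes> x l) \<in> Units R"
  shows "rank_one_update R n x y \<in> GL n R"
proof -
  define s where "s = (\<Oplus>l\<in>{..<n}. y l \<otimes> x l)"
  have s[simp]: "s \<in> carrier R" unfolding s_def by (auto intro!: finsum_closed)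
  define c where "c = \<ominus> (inv (\<one> \<oplus> s))"
  have u': "\<one> \<oplus> s \<in> Units R" using u by (simp add: s_def)
  then have i[simp]: "inv (\<one> \<oplus> s) \<in> carrier R" by auto
  then have c[simp]: "c \<in> carrier R" by (simp add: c_def)
  have "c \<oplus> \<one> \<oplus> c \<otimes> s = \<one> \<ominus> inv (\<one> \<oplus> s) \<otimes> (\<one> \<oplus> s)"
    unfolding c_def using s i by algebra
  also have "\<dots> = \<zero>" using u' by (simp add: a_minus_def r_neg)
  finally have 0: "c \<oplus> \<one> \<oplus> c \<otimes> s = \<zero>" .
  then have 1: "\<one> \<oplus> c \<oplus> c \<otimes> s = \<zero>" by (simp add: a_comm)
  let ?A = "rank_one_update R n (\<lambda>i. \<one> \<otimes> x i) y"
  let ?B = "rank_one_update R n (\<lambda>i. c \<otimes> x i) y"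
  have A: "rank_one_update R n x y = ?A"
    unfolding rank_one_update_def by (intro eq_matI) auto
  have "?B \<otimes>\<^bsub>mat_monoid R n\<^esub> ?A = \<one>\<^bsub>mat_monoid R n\<^esub>"
    using rank_one_update_mult[OF x y c one_closed] 0 rank_one_update_zero[OF x y]
    by (simp add: s_def)
  moreover have "?A \<otimes>\<^bsub>mat_monoid R n\<^esub> ?B = \<one>\<^bsub>mat_monoid R n\<^esub>"
    using rank_one_update_mult[OF x y one_closed c] 1 rank_one_update_zero[OF x y]
    by (simp add: s_def)
  moreover have "?A \<in> carrier (mat_monoid R n)" "?B \<in> carrier (mat_monoid R n)"
    by (auto intro!: rank_one_update_closed)
  ultimately show ?thesis
    unfolding GL_def Units_def A by blast
qed

end

section \<open>The Zelisko group\<close>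

lemma (in monoid) divides_chain:
  assumes "\<And>i. i < n \<Longrightarrow> \<phi> i \<in> carrier G" "\<And>i. Suc i < n \<Longrightarrow> \<phi> i divides \<phi> (Suc i)"
    "i \<le> j" "j < n"
  shows "\<phi> i divides \<phi> j"
  using assms(3,4)
proof (induction j rule: dec_induct)
  case base
  then show ?case using assms(1) by simp
next
  case (step j)
  then show ?case using assms(1,2) by (meson Suc_lessD divides_trans le_less_trans)
qed

lemma (in monoid) intertwine_mult:
  assumes "A \<in> carrier G" "B \<in> carrier G" "S \<in> carrier G" "T \<in> carrier G" "\<Phi> \<in> carrier G"
    and "A \<otimes> \<Phi> = \<Phi> \<otimes> S" "B \<otimes> \<Phi> = \<Phi> \<otimes> T"
  shows "(A \<otimes> B) \<otimes> \<Phi> = \<Phi> \<otimes> (S \<otimes> T)"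
  using assms by (metis m_assoc)

lemma (in monoid) intertwine_inv:
  assumes "A \<in> Units G" "S \<in> Units G" "\<Phi> \<in> carrier G" and "A \<otimes> \<Phi> = \<Phi> \<otimes> S"
  shows "inv A \<otimes> \<Phi> = \<Phi> \<otimes> inv S"
proof -
  have [simp]: "A \<in> carrier G" "S \<in> carrier G" "inv A \<in> carrier G" "inv S \<in> carrier G"
    using assms by auto
  have "inv A \<otimes> \<Phi> = inv A \<otimes> (\<Phi> \<otimes> S) \<otimes> inv S"
    using assms(1-3) by (simp add: m_assoc)
  also have "\<dots> = inv A \<otimes> (A \<otimes> \<Phi>) \<otimes> inv S" using assms(4) by simp
  also have "\<dots> = \<Phi> \<otimes> inv S" using assms(1-3) by (simp add: m_assoc[symmetric])
  finally show ?thesis .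
qed

context cring
begin

lemma diagonal_matrix_closed:
  assumes "\<And>i. i < n \<Longrightarrow> \<phi> i \<in> carrier R"
  shows "diagonal_matrix R n \<phi> \<in> carrier (mat_monoid R n)"
  using assms by (intro mat_monoid_carrierI) (auto simp: diagonal_matrix_def)

lemma intertwines_diagonal_iff:
  assumes A: "A \<in> carrier (mat_monoid R n)" and S: "S \<in> carrier (mat_monoid R n)"
    and \<phi>: "\<And>i. i < n \<Longrightarrow> \<phi> i \<in> carrier R"
  shows "A \<otimes>\<^bsub>mat_monoid R n\<^esub> diagonal_matrix R n \<phi> = diagonal_matrix R n \<phi> \<otimes>\<^bsub>mat_monoid R n\<^esub> S \<longleftrightarrow>
    (\<forall>i<n. \<forall>j<n. A $$ (i, j) \<otimes> \<phi> j = \<phi> i \<otimes> S $$ (i, j))"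
proof -
  note [simp] = mat_monoid_carrierD(3)[OF A] mat_monoid_carrierD(3)[OF S] \<phi>
  let ?\<Phi> = "diagonal_matrix R n \<phi>"
  have 1: "(A \<otimes>\<^bsub>mat_monoid R n\<^esub> ?\<Phi>) $$ (i, j) = A $$ (i, j) \<otimes> \<phi> j"
    if [simp]: "i < n" "j < n" for i j
  proof -
    have "(A \<otimes>\<^bsub>mat_monoid R n\<^esub> ?\<Phi>) $$ (i, j) =
      (\<Oplus>l\<in>{..<n}. (A $$ (i, l) \<otimes> \<phi> l) \<otimes> kronecker R l j)"
      by (auto simp: mat_monoid_mult_index diagonal_matrix_def intro!: finsum_cong')
    also have "\<dots> = A $$ (i, j) \<otimes> \<phi> j" by (rule finsum_kronecker_right) auto
    finally show ?thesis .
  qed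
  have 2: "(?\<Phi> \<otimes>\<^bsub>mat_monoid R n\<^esub> S) $$ (i, j) = \<phi> i \<otimes> S $$ (i, j)"
    if [simp]: "i < n" "j < n" for i j
  proof -
    have "(?\<Phi> \<otimes>\<^bsub>mat_monoid R n\<^esub> S) $$ (i, j) =
      (\<Oplus>l\<in>{..<n}. kronecker R i l \<otimes> (\<phi> l \<otimes> S $$ (l, j)))"
      by (auto simp: mat_monoid_mult_index diagonal_matrix_def intro!: finsum_cong')
    also have "\<dots> = \<phi> i \<otimes> S $$ (i, j)" by (rule finsum_kronecker_left) auto
    finally show ?thesis .
  qed
  have "?\<Phi> \<in> carrier (mat_monoid R n)" by (rule diagonal_matrix_closed[of n \<phi>, OF \<phi>])
  then have c: "A \<otimes>\<^bsub>mat_monoid R n\<^esub> ?\<Phi> \<in> carrier (mat_monoid R n)"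
    "?\<Phi> \<otimes>\<^bsub>mat_monoid R n\<^esub> S \<in> carrier (mat_monoid R n)"
    using A S by (auto intro: mat_monoid_mult_closed)
  show ?thesis
    using mat_monoid_eqI[OF c] by (metis 1 2)
qed

text \<open>
  The entries of an intertwiner \<open>S\<close> can be chosen independently of each other, so its existence is a
  divisibility condition on each entry of \<open>A\<close>. This condition is the invariant of the elimination.
\<close>
lemma intertwiner_exists_iff:
  assumes A: "A \<in> carrier (mat_monoid R n)" and \<phi>: "\<And>i. i < n \<Longrightarrow> \<phi> i \<in> carrier R"
  shows "(\<exists>S\<in>carrier (mat_monoid R n).
      A \<otimes>\<^bsub>mat_monoid R n\<^esub> diagonal_matrix R n \<phi> = diagonal_matrix R n \<phi> \<otimes>\<^bsub>mat_monoid R n\<^esub> S) \<longleftrightarrow>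
    (\<forall>i<n. \<forall>j<n. \<phi> i divides A $$ (i, j) \<otimes> \<phi> j)"
proof
  assume "\<exists>S\<in>carrier (mat_monoid R n).
      A \<otimes>\<^bsub>mat_monoid R n\<^esub> diagonal_matrix R n \<phi> = diagonal_matrix R n \<phi> \<otimes>\<^bsub>mat_monoid R n\<^esub> S"
  then obtain S where S: "S \<in> carrier (mat_monoid R n)"
    and "\<forall>i<n. \<forall>j<n. A $$ (i, j) \<otimes> \<phi> j = \<phi> i \<otimes> S $$ (i, j)"
    using intertwines_diagonal_iff[where \<phi> = \<phi>, OF A _ \<phi>] by blast
  then show "\<forall>i<n. \<forall>j<n. \<phi> i divides A $$ (i, j) \<otimes> \<phi> j"
    using mat_monoid_carrierD(3)[OF S] by (auto simp: factor_def)
next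
  assume "\<forall>i<n. \<forall>j<n. \<phi> i divides A $$ (i, j) \<otimes> \<phi> j"
  then have "\<forall>i j. \<exists>s. i < n \<longrightarrow> j < n \<longrightarrow> s \<in> carrier R \<and> A $$ (i, j) \<otimes> \<phi> j = \<phi> i \<otimes> s"
    unfolding factor_def by blast
  then obtain s where s: "\<forall>i j. i < n \<longrightarrow> j < n \<longrightarrow> s i j \<in> carrier R \<and> A $$ (i, j) \<otimes> \<phi> j = \<phi> i \<otimes> s i j"
    by metis
  have S: "mat n n (\<lambda>(i, j). s i j) \<in> carrier (mat_monoid R n)"
    using s by (intro mat_monoid_carrierI) auto
  have "A \<otimes>\<^bsub>mat_monoid R n\<^esub> diagonal_matrix R n \<phi> =
    diagonal_matrix R n \<phi> \<otimes>\<^bsub>mat_monoid R n\<^esub> mat n n (\<lambda>(i, j). s i j)"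
    using s by (subst intertwines_diagonal_iff[where \<phi> = \<phi>, OF A S \<phi>]) auto
  with S show "\<exists>S\<in>carrier (mat_monoid R n).
      A \<otimes>\<^bsub>mat_monoid R n\<^esub> diagonal_matrix R n \<phi> = diagonal_matrix R n \<phi> \<otimes>\<^bsub>mat_monoid R n\<^esub> S"
    by blast
qed

text \<open>
  The witness for membership is the rank-one update by \<open>x'\<close> and \<open>y'\<close>: passing through \<open>\<phi>\<^sub>k\<close> gives
  \<open>x\<^sub>i y\<^sub>j \<phi>\<^sub>j = x\<^sub>i \<phi>\<^sub>k y'\<^sub>j = \<phi>\<^sub>i x'\<^sub>i y'\<^sub>j\<close>.
\<close>
lemma rank_one_update_zelisko:
  assumes \<phi>: "\<And>i. i < n \<Longrightarrow> \<phi> i \<in> carrier R" and k: "k < n"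
    and x: "\<And>i. i < n \<Longrightarrow> x i \<in> carrier R \<and> x' i \<in> carrier R \<and> x i \<otimes> \<phi> k = \<phi> i \<otimes> x' i"
    and y: "\<And>i. i < n \<Longrightarrow> y i \<in> carrier R \<and> y' i \<in> carrier R \<and> y i \<otimes> \<phi> i = \<phi> k \<otimes> y' i"
    and "\<one> \<oplus> (\<Oplus>l\<in>{..<n}. y l \<otimes> x l) \<in> Units R" "\<one> \<oplus> (\<Oplus>l\<in>{..<n}. y' l \<otimes> x' l) \<in> Units R"
  shows "rank_one_update R n x y \<in> zelisko_group R n (diagonal_matrix R n \<phi>)"
proof -
  have G: "rank_one_update R n x y \<in> GL n R" "rank_one_update R n x' y' \<in> GL n R"
    using assms by (auto intro!: rank_one_update_GL)
  have "rank_one_update R n x y \<otimes>\<^bsub>mat_monoid R n\<^esub> diagonal_matrix R n \<phi> =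
    diagonal_matrix R n \<phi> \<otimes>\<^bsub>mat_monoid R n\<^esub> rank_one_update R n x' y'"
  proof (subst intertwines_diagonal_iff[where \<phi> = \<phi>, OF _ _ \<phi>], goal_cases)
    case 4
    show ?case
    proof (intro allI impI)
      fix i j assume ij[simp]: "i < n" "j < n"
      have e: "x i \<in> carrier R" "x' i \<in> carrier R" "y j \<in> carrier R" "y' j \<in> carrier R"
        "\<phi> i \<in> carrier R" "\<phi> j \<in> carrier R" "\<phi> k \<in> carrier R" "kronecker R i j \<in> carrier R"
        using x[OF ij(1)] y[OF ij(2)] \<phi> k by auto
      have "x i \<otimes> y j \<otimes> \<phi> j = x i \<otimes> \<phi> k \<otimes> y' j"
        using e y[OF ij(2)] by (simp add: m_assoc)
      also have "\<dots> = \<phi> i \<otimes> (x' i \<otimes> y' j)"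
        using e x[OF ij(1)] by (simp add: m_assoc[symmetric])
      finally have "x i \<otimes> y j \<otimes> \<phi> j = \<phi> i \<otimes> (x' i \<otimes> y' j)" .
      moreover have "kronecker R i j \<otimes> \<phi> j = \<phi> i \<otimes> kronecker R i j" using e by auto
      ultimately show "rank_one_update R n x y $$ (i, j) \<otimes> \<phi> j =
          \<phi> i \<otimes> rank_one_update R n x' y' $$ (i, j)"
        using e by (simp only: rank_one_update_index ij l_distr r_distr m_closed)
    qed
  qed (use x y in \<open>auto intro!: rank_one_update_closed\<close>)
  with G show ?thesis unfolding zelisko_group_def by blast
qed

lemma zelisko_group_mult:
  assumes \<phi>: "\<And>i. i < n \<Longrightarrow> \<phi> i \<in> carrier R"
    and "A \<in> zelisko_group R n (diagonal_matrix R n \<phi>)" "B \<in> zelisko_group R n (diagonal_matrix R n \<phi>)"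
  shows "A \<otimes>\<^bsub>mat_monoid R n\<^esub> B \<in> zelisko_group R n (diagonal_matrix R n \<phi>)"
proof -
  interpret M: monoid "mat_monoid R n" by (rule monoid_mat_monoid)
  obtain S T where "A \<in> GL n R" "B \<in> GL n R" and ST: "S \<in> GL n R" "T \<in> GL n R"
    and "A \<otimes>\<^bsub>mat_monoid R n\<^esub> diagonal_matrix R n \<phi> = diagonal_matrix R n \<phi> \<otimes>\<^bsub>mat_monoid R n\<^esub> S"
      "B \<otimes>\<^bsub>mat_monoid R n\<^esub> diagonal_matrix R n \<phi> = diagonal_matrix R n \<phi> \<otimes>\<^bsub>mat_monoid R n\<^esub> T"
    using assms(2,3) unfolding zelisko_group_def by blast
  then show ?thesis
    using M.intertwine_mult[of A B S T, OF _ _ _ _ diagonal_matrix_closed[of n \<phi>, OF \<phi>]]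
    unfolding zelisko_group_def GL_def
    by (auto intro!: bexI[of _ "S \<otimes>\<^bsub>mat_monoid R n\<^esub> T"])
qed

lemma zelisko_group_inv:
  assumes \<phi>: "\<And>i. i < n \<Longrightarrow> \<phi> i \<in> carrier R"
    and "A \<in> zelisko_group R n (diagonal_matrix R n \<phi>)"
  shows "inv\<^bsub>mat_monoid R n\<^esub> A \<in> zelisko_group R n (diagonal_matrix R n \<phi>)"
proof -
  interpret M: monoid "mat_monoid R n" by (rule monoid_mat_monoid)
  obtain S where "A \<in> GL n R" "S \<in> GL n R"
    and "A \<otimes>\<^bsub>mat_monoid R n\<^esub> diagonal_matrix R n \<phi> = diagonal_matrix R n \<phi> \<otimes>\<^bsub>mat_monoid R n\<^esub> S"
    using assms(2) unfolding zelisko_group_def by blast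
  then show ?thesis
    using M.intertwine_inv[of A S, OF _ _ diagonal_matrix_closed[of n \<phi>, OF \<phi>]]
    unfolding zelisko_group_def GL_def
    by (auto intro!: bexI[of _ "inv\<^bsub>mat_monoid R n\<^esub> S"])
qed

text \<open>
  The entries left of position \<open>k\<close> enter through a single linear combination \<open>b\<close>, so a unimodular row
  needs no more than the two-element form of stable range one.
\<close>
lemma stable_range_one_row:
  fixes k n :: nat
  assumes sr: "stable_range_one R" and k: "k < n"
    and a[simp]: "\<And>l. l < n \<Longrightarrow> a l \<in> carrier R" and x[simp]: "\<And>l. l < n \<Longrightarrow> x l \<in> carrier R"
    and one: "(\<Oplus>l\<in>{..<n}. a l \<otimes> x l) = \<one>" and zero: "\<And>l. k < l \<Longrightarrow> l < n \<Longrightarrow> a l = \<zero>"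
  obtains v where "\<And>l. v l \<in> carrier R" "\<And>l. k \<le> l \<Longrightarrow> v l = \<zero>"
    "a k \<oplus> (\<Oplus>l\<in>{..<n}. a l \<otimes> v l) \<in> Units R"
proof -
  have kn[simp]: "l < n" if "l < k" for l using that k by (rule less_trans)
  note [simp] = k
  define b where "b = (\<Oplus>l\<in>{..<k}. a l \<otimes> x l)"
  have b[simp]: "b \<in> carrier R" unfolding b_def by (auto intro!: finsum_closed)
  have "(\<Oplus>l\<in>{..<n}. a l \<otimes> x l) = (\<Oplus>l\<in>{..k}. a l \<otimes> x l)"
    using zero by (intro add.finprod_mono_neutral_cong_right) (auto intro: le_less_trans[OF _ k])
  also have "{..k} = insert k {..<k}" by auto
  also have "(\<Oplus>l\<in>insert k {..<k}. a l \<otimes> x l) = a k \<otimes> x k \<oplus> b"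
    unfolding b_def by (subst finsum_insert) auto
  finally have "a k \<otimes> x k \<oplus> b = \<one>" by (metis one)
  then have "a k \<otimes> x k \<oplus> b \<otimes> \<one> = \<one>" by simp
  then obtain r where r[simp]: "r \<in> carrier R" and u: "a k \<oplus> b \<otimes> r \<in> Units R"
    using stable_range_oneD[OF sr, of "a k" b "x k" \<one>] by auto
  define v where "v l = (if l < k then x l \<otimes> r else \<zero>)" for l
  have "(\<Oplus>l\<in>{..<n}. a l \<otimes> v l) = (\<Oplus>l\<in>{..<k}. a l \<otimes> x l \<otimes> r)"
    by (intro add.finprod_mono_neutral_cong_right) (auto simp: v_def m_assoc less_imp_le[OF k])
  also have "\<dots> = b \<otimes> r"
    unfolding b_def by (intro finsum_ldistr[symmetric]) auto
  finally show thesis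
    using u k by (intro that[of v]) (auto simp: v_def)
qed

lemma add_minus_cancel:
  assumes "a \<in> carrier R" "b \<in> carrier R"
  shows "a \<oplus> (b \<ominus> a) = b"
  using assms by algebra

text \<open>
  Induction on the size \<open>k\<close> of the leading block outside of which \<open>H\<close> agrees with the identity. In the
  step, \<open>V\<close> makes the corner entry \<open>(k, k)\<close> a unit, \<open>W\<close> clears row \<open>k\<close>, and \<open>X\<close> clears column \<open>k\<close>.
  All three belong to the Zelisko group, hence \<open>X H V W\<close> satisfies the hypotheses for the smaller
  block, and \<open>H\<close> is recovered from it inside the group.
\<close>
lemma invertible_intertwiner_in_zelisko_group:
  assumes sr: "stable_range_one R" and \<phi>: "\<And>i. i < n \<Longrightarrow> \<phi> i \<in> carrier R"
    and dvd: "\<And>i j. i \<le> j \<Longrightarrow> j < n \<Longrightarrow> \<phi> i divides \<phi> j"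
    and "k \<le> n" and "H \<in> GL n R"
    and "\<And>i j. i < n \<Longrightarrow> j < n \<Longrightarrow> \<phi> i divides H $$ (i, j) \<otimes> \<phi> j"
    and "\<And>i j. i < n \<Longrightarrow> j < n \<Longrightarrow> k \<le> i \<or> k \<le> j \<Longrightarrow> H $$ (i, j) = kronecker R i j"
  shows "H \<in> zelisko_group R n (diagonal_matrix R n \<phi>)"
  using assms(4-7)
proof (induction k arbitrary: H)
  let ?M = "mat_monoid R n" and ?\<Phi> = "diagonal_matrix R n \<phi>"
  interpret M: monoid ?M by (rule monoid_mat_monoid)
  {
    case 0
    have "H = \<one>\<^bsub>?M\<^esub>"
      using 0 by (intro mat_monoid_eqI[where Q = R and n = n])
        (auto simp: GL_def mat_monoid_one_index)
    then show ?case
      using diagonal_matrix_closed[of n \<phi>, OF \<phi>]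
      unfolding zelisko_group_def GL_def by (auto intro!: bexI[of _ "\<one>\<^bsub>?M\<^esub>"])
  next
    case (Suc k)
    have k[simp]: "k < n" using Suc.prems(1) by simp
    have HM: "H \<in> carrier ?M" using Suc.prems(2) by (auto simp: GL_def)
    note Hc[simp] = mat_monoid_carrierD(3)[OF HM]
    have Hid: "H $$ (i, j) = kronecker R i j" if "i < n" "j < n" "k < i \<or> k < j" for i j
      using Suc.prems(4)[OF that(1,2)] that(3) by auto
    let ?e = "kronecker R k"
    have e[simp]: "?e l \<in> carrier R" for l by simp
    have e_sum: "(\<Oplus>l\<in>{..<n}. ?e l \<otimes> f l) = f k" "(\<Oplus>l\<in>{..<n}. f l \<otimes> ?e l) = f k"
      if f: "\<And>l. l < n \<Longrightarrow> f l \<in> carrier R" for f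
    proof -
      show "(\<Oplus>l\<in>{..<n}. ?e l \<otimes> f l) = f k" by (rule finsum_kronecker_left[OF k f])
      have "(\<Oplus>l\<in>{..<n}. f l \<otimes> ?e l) = (\<Oplus>l\<in>{..<n}. ?e l \<otimes> f l)"
        using f by (intro finsum_cong') (auto simp: m_comm)
      also have "\<dots> = f k" by (rule finsum_kronecker_left[OF k f])
      finally show "(\<Oplus>l\<in>{..<n}. f l \<otimes> ?e l) = f k" .
    qed
    \<comment> \<open>Column \<open>k\<close> of the identity may be changed above the diagonal at will, since \<open>\<phi>\<^sub>i\<close> divides \<open>\<phi>\<^sub>k\<close>
      for \<open>i < k\<close>.\<close>
    have col: "rank_one_update R n v ?e \<in> zelisko_group R n ?\<Phi>"
      if v: "\<And>l. l < n \<Longrightarrow> v l \<in> carrier R" "\<And>l. k \<le> l \<Longrightarrow> l < n \<Longrightarrow> v l = \<zero>" for v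
    proof -
      have "\<exists>t. t \<in> carrier R \<and> \<phi> k = \<phi> i \<otimes> t" if "i < k" for i
        using dvd[of i k] that by (auto simp: factor_def)
      then obtain t where t: "\<And>i. i < k \<Longrightarrow> t i \<in> carrier R" "\<And>i. i < k \<Longrightarrow> \<phi> k = \<phi> i \<otimes> t i"
        by metis
      define v' where "v' i = (if i < k then t i \<otimes> v i else \<zero>)" for i
      have v': "v' i \<in> carrier R" "v i \<otimes> \<phi> k = \<phi> i \<otimes> v' i" if "i < n" for i
      proof -
        show "v' i \<in> carrier R" using that v t by (auto simp: v'_def)
        show "v i \<otimes> \<phi> k = \<phi> i \<otimes> v' i"
        proof (cases "i < k")
          case True
          then have "v i \<otimes> \<phi> k = v i \<otimes> (\<phi> i \<otimes> t i)" using t(2) by metis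
          then show ?thesis using True that v(1)[OF that] t(1)[OF True] \<phi>[OF that]
            by (simp add: v'_def m_ac)
        next
          case False
          then show ?thesis using that v(2) \<phi> by (simp add: v'_def)
        qed
      qed
      show ?thesis
        by (rule rank_one_update_zelisko[of n \<phi>, OF \<phi> k, where x' = v' and y' = ?e])
          (use v v' in \<open>auto simp: e_sum \<phi>, auto simp: v'_def\<close>)
    qed

    \<comment> \<open>Row \<open>k\<close> of \<open>H\<close> is unimodular: multiply it with column \<open>k\<close> of the inverse.\<close>
    have "H \<otimes>\<^bsub>?M\<^esub> inv\<^bsub>?M\<^esub> H = \<one>\<^bsub>?M\<^esub>" and iM: "inv\<^bsub>?M\<^esub> H \<in> carrier ?M"
      using Suc.prems(2) by (auto simp: GL_def)
    then have "(\<Oplus>l\<in>{..<n}. H $$ (k, l) \<otimes> (inv\<^bsub>?M\<^esub> H) $$ (l, k)) = \<one>"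
      using mat_monoid_mult_index[OF k k, of R H "inv\<^bsub>?M\<^esub> H"] by (simp add: mat_monoid_one_index)
    then obtain v where v[simp]: "\<And>l. v l \<in> carrier R" and v0: "\<And>l. k \<le> l \<Longrightarrow> v l = \<zero>"
      and u: "H $$ (k, k) \<oplus> (\<Oplus>l\<in>{..<n}. H $$ (k, l) \<otimes> v l) \<in> Units R"
      by (rule stable_range_one_row[OF sr k, rotated 2])
        (use Hid mat_monoid_carrierD(3)[OF iM] in auto)

    define V where "V = rank_one_update R n v ?e"
    have VZ: "V \<in> zelisko_group R n ?\<Phi>" unfolding V_def by (rule col) (auto simp: v0)
    have VM: "V \<in> carrier ?M" unfolding V_def by (auto intro!: rank_one_update_closed)
    define A where "A = H \<otimes>\<^bsub>?M\<^esub> V"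
    have AM: "A \<in> carrier ?M" unfolding A_def using HM VM by simp
    note Ac[simp] = mat_monoid_carrierD(3)[OF AM]
    have A: "A $$ (i, j) = H $$ (i, j) \<oplus> (\<Oplus>l\<in>{..<n}. H $$ (i, l) \<otimes> v l) \<otimes> ?e j"
      if "i < n" "j < n" for i j
      unfolding A_def V_def by (rule mult_rank_one_update_index[OF HM that]) auto
    have Aid: "A $$ (i, j) = kronecker R i j" if ij: "i < n" "j < n" "k < i \<or> k < j" for i j
    proof (cases "k < j")
      case True
      then show ?thesis using ij Hid by (auto simp: A intro!: r_null finsum_closed)
    next
      case False
      then have "k < i" using ij by simp
      then have "(\<Oplus>l\<in>{..<n}. H $$ (i, l) \<otimes> v l) = \<zero>"
        using ij by (intro add.finprod_one_eqI) (auto simp: Hid v0)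
      then show ?thesis using ij Hid by (auto simp: A)
    qed
    define u where "u = A $$ (k, k)"
    have u[simp]: "u \<in> Units R" "u \<in> carrier R" "inv u \<in> carrier R"
      using u A[OF k k] unfolding u_def by (auto intro!: finsum_closed)
    have "\<exists>S\<in>carrier ?M. A \<otimes>\<^bsub>?M\<^esub> ?\<Phi> = ?\<Phi> \<otimes>\<^bsub>?M\<^esub> S"
    proof -
      obtain S where "S \<in> carrier ?M" "H \<otimes>\<^bsub>?M\<^esub> ?\<Phi> = ?\<Phi> \<otimes>\<^bsub>?M\<^esub> S"
        using intertwiner_exists_iff[of H n \<phi>, OF HM \<phi>] Suc.prems(3) by blast
      moreover obtain T where "T \<in> carrier ?M" "V \<otimes>\<^bsub>?M\<^esub> ?\<Phi> = ?\<Phi> \<otimes>\<^bsub>?M\<^esub> T"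
        using VZ by (auto simp: zelisko_group_def GL_def)
      ultimately show ?thesis
        using M.intertwine_mult[of H V S T, OF HM VM _ _ diagonal_matrix_closed[of n \<phi>, OF \<phi>]]
        unfolding A_def by blast
    qed
    then have Adiv: "\<phi> i divides A $$ (i, j) \<otimes> \<phi> j" if "i < n" "j < n" for i j
      using intertwiner_exists_iff[of A n \<phi>, OF AM \<phi>] that by blast

    \<comment> \<open>Adding \<open>w\<^sub>j\<close> times column \<open>k\<close> to column \<open>j\<close> clears row \<open>k\<close>; for \<open>j = k\<close> the formula rescales column
      \<open>k\<close> by \<open>1 + w\<^sub>k = 1 / u\<close>, which turns the corner into \<open>1\<close>.\<close>
    define w where "w j = inv u \<otimes> (?e j \<ominus> A $$ (k, j))" for j
    have w[simp]: "w j \<in> carrier R" if "j < n" for j using that by (simp add: w_def)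
    have wk: "\<one> \<oplus> w k = inv u"
    proof -
      have "w k = inv u \<otimes> (\<one> \<ominus> u)" by (simp add: w_def u_def)
      also have "\<dots> = inv u \<ominus> inv u \<otimes> u" using u(2,3) by algebra
      also have "\<dots> = inv u \<ominus> \<one>" using u(1) by simp
      finally have "\<one> \<oplus> w k = \<one> \<oplus> (inv u \<ominus> \<one>)" by simp
      also have "\<dots> = inv u" using u(3) by algebra
      finally show ?thesis .
    qed
    have distr: "i \<otimes> (f \<otimes> a \<ominus> f \<otimes> b) = f \<otimes> (i \<otimes> (a \<ominus> b))"
      if "i \<in> carrier R" "f \<in> carrier R" "a \<in> carrier R" "b \<in> carrier R" for i f a b
      using that by algebra
    have "\<exists>s. s \<in> carrier R \<and> w j \<otimes> \<phi> j = \<phi> k \<otimes> s" if j[simp]: "j < n" for j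
    proof -
      obtain s where s[simp]: "s \<in> carrier R" and As: "A $$ (k, j) \<otimes> \<phi> j = \<phi> k \<otimes> s"
        using Adiv[OF k j] by (auto simp: factor_def)
      have c: "\<phi> j \<in> carrier R" "\<phi> k \<in> carrier R" using \<phi> by auto
      have "w j \<otimes> \<phi> j = inv u \<otimes> (?e j \<otimes> \<phi> j \<ominus> A $$ (k, j) \<otimes> \<phi> j)"
        unfolding w_def using c(1) u(3) Ac[OF k j] e[of j]
        by (simp add: a_minus_def l_distr l_minus m_assoc)
      also have "\<dots> = inv u \<otimes> (\<phi> k \<otimes> ?e j \<ominus> \<phi> k \<otimes> s)"
        using c As by auto
      also have "\<dots> = \<phi> k \<otimes> (inv u \<otimes> (?e j \<ominus> s))"
        by (rule distr) (use c u(3) s e in auto)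
      finally show ?thesis using s u(3) e[of j] by (intro exI[of _ "inv u \<otimes> (?e j \<ominus> s)"]) auto
    qed
    then obtain w0 where w0: "\<And>j. j < n \<Longrightarrow> w0 j \<in> carrier R"
      "\<And>j. j < n \<Longrightarrow> w j \<otimes> \<phi> j = \<phi> k \<otimes> w0 j" by metis
    \<comment> \<open>The value of \<open>w'\<close> at \<open>k\<close> is prescribed, because \<open>w0 k\<close> is determined only up to the annihilator of
      \<open>\<phi>\<^sub>k\<close> and \<open>1 + w0 k\<close> need not be a unit.\<close>
    define w' where "w' = w0(k := w k)"
    have w': "w' j \<in> carrier R" "w j \<otimes> \<phi> j = \<phi> k \<otimes> w' j" if "j < n" for j
      using w0 that \<phi> by (auto simp: w'_def m_comm)
    define W where "W = rank_one_update R n ?e w"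
    have WZ: "W \<in> zelisko_group R n ?\<Phi>"
      unfolding W_def
    proof (rule rank_one_update_zelisko[of n \<phi>, OF \<phi> k, where x' = ?e and y' = w'])
      show "\<one> \<oplus> (\<Oplus>l\<in>{..<n}. w l \<otimes> ?e l) \<in> Units R"
        using e_sum(2)[of w] wk by simp
      show "\<one> \<oplus> (\<Oplus>l\<in>{..<n}. w' l \<otimes> ?e l) \<in> Units R"
        using e_sum(2)[of w'] w' wk by (simp add: w'_def)
    qed (use w' \<phi> in auto)
    define B where "B = A \<otimes>\<^bsub>?M\<^esub> W"
    have WM: "W \<in> carrier ?M" unfolding W_def by (auto intro!: rank_one_update_closed)
    have BM: "B \<in> carrier ?M" unfolding B_def using AM WM by simp
    note Bc[simp] = mat_monoid_carrierD(3)[OF BM]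
    have B: "B $$ (i, j) = A $$ (i, j) \<oplus> A $$ (i, k) \<otimes> w j" if ij: "i < n" "j < n" for i j
    proof -
      have "B $$ (i, j) = A $$ (i, j) \<oplus> (\<Oplus>l\<in>{..<n}. A $$ (i, l) \<otimes> ?e l) \<otimes> w j"
        unfolding B_def W_def by (rule mult_rank_one_update_index[OF AM ij]) auto
      then show ?thesis using e_sum(2)[of "\<lambda>l. A $$ (i, l)"] ij by simp
    qed
    have Bk: "B $$ (k, j) = ?e j" if j: "j < n" for j
    proof -
      have "B $$ (k, j) = A $$ (k, j) \<oplus> u \<otimes> inv u \<otimes> (?e j \<ominus> A $$ (k, j))"
        unfolding B[OF k j] u_def[symmetric] w_def using j u by (simp add: m_assoc[symmetric])
      also have "\<dots> = ?e j"
        using u(1) Ac[OF k j] e[of j] by (simp only: Units_r_inv l_one minus_closed add_minus_cancel)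
      finally show ?thesis .
    qed
    have Bid: "B $$ (i, j) = kronecker R i j" if ij: "i < n" "j < n" "k < i \<or> k < j" for i j
    proof (cases "k < j")
      case True
      then have "w j = \<zero>" using Aid[OF k ij(2)] by (simp add: w_def a_minus_def)
      then show ?thesis using ij by (auto simp: B Aid)
    next
      case False
      then show ?thesis using ij by (auto simp: B Aid)
    qed

    \<comment> \<open>Row \<open>k\<close> is now a unit vector, so adding \<open>x\<^sub>i\<close> times row \<open>k\<close> to row \<open>i\<close> changes column \<open>k\<close> only.\<close>
    define x where "x i = kronecker R i k \<ominus> B $$ (i, k)" for i
    have x[simp]: "x i \<in> carrier R" if "i < n" for i using that by (simp add: x_def)
    have x0: "x i = \<zero>" if "k \<le> i" "i < n" for i
      using that Bk[OF k] Bid[of i k] by (cases "i = k") (auto simp: x_def a_minus_def r_neg)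
    define X where "X = rank_one_update R n x ?e"
    have XZ: "X \<in> zelisko_group R n ?\<Phi>" unfolding X_def by (rule col) (auto simp: x0)
    have XM: "X \<in> carrier ?M" unfolding X_def by (auto intro!: rank_one_update_closed)
    define C where "C = X \<otimes>\<^bsub>?M\<^esub> B"
    have CM: "C \<in> carrier ?M" unfolding C_def using XM BM by simp
    have C: "C $$ (i, j) = B $$ (i, j) \<oplus> x i \<otimes> ?e j" if ij: "i < n" "j < n" for i j
    proof -
      have "C $$ (i, j) = B $$ (i, j) \<oplus> x i \<otimes> (\<Oplus>l\<in>{..<n}. ?e l \<otimes> B $$ (l, j))"
        unfolding C_def X_def by (rule rank_one_update_mult_index[OF BM ij]) auto
      then show ?thesis using e_sum(1)[of "\<lambda>l. B $$ (l, j)"] ij Bk by simp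
    qed
    have Cid: "C $$ (i, j) = kronecker R i j" if ij: "i < n" "j < n" "k \<le> i \<or> k \<le> j" for i j
    proof (cases "j = k")
      case True
      have "C $$ (i, k) = B $$ (i, k) \<oplus> (kronecker R i k \<ominus> B $$ (i, k))"
        using C[OF ij(1) k] ij by (simp add: x_def)
      also have "\<dots> = kronecker R i k"
        using Bc[OF ij(1) k] by (intro add_minus_cancel) auto
      finally show ?thesis using True by simp
    next
      case False
      then have "C $$ (i, j) = B $$ (i, j)" using ij by (simp add: C)
      then show ?thesis using ij False Bk Bid by (cases "i = k") auto
    qed

    have C_eq: "C = X \<otimes>\<^bsub>?M\<^esub> (H \<otimes>\<^bsub>?M\<^esub> V \<otimes>\<^bsub>?M\<^esub> W)" by (simp add: C_def B_def A_def)
    have G: "X \<in> Units ?M" "V \<in> Units ?M" "W \<in> Units ?M" "H \<in> Units ?M"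
      using XZ VZ WZ Suc.prems(2) by (auto simp: zelisko_group_def GL_def)
    have "\<exists>S\<in>carrier ?M. C \<otimes>\<^bsub>?M\<^esub> ?\<Phi> = ?\<Phi> \<otimes>\<^bsub>?M\<^esub> S"
    proof -
      obtain S where "S \<in> carrier ?M" "A \<otimes>\<^bsub>?M\<^esub> ?\<Phi> = ?\<Phi> \<otimes>\<^bsub>?M\<^esub> S"
        using intertwiner_exists_iff[of A n \<phi>, OF AM \<phi>] Adiv by blast
      moreover obtain T where "T \<in> carrier ?M" "W \<otimes>\<^bsub>?M\<^esub> ?\<Phi> = ?\<Phi> \<otimes>\<^bsub>?M\<^esub> T"
        using WZ by (auto simp: zelisko_group_def GL_def)
      ultimately have "S \<otimes>\<^bsub>?M\<^esub> T \<in> carrier ?M" "B \<otimes>\<^bsub>?M\<^esub> ?\<Phi> = ?\<Phi> \<otimes>\<^bsub>?M\<^esub> (S \<otimes>\<^bsub>?M\<^esub> T)"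
        using M.intertwine_mult[of A W S T, OF AM WM _ _ diagonal_matrix_closed[of n \<phi>, OF \<phi>]]
        unfolding B_def by auto
      moreover obtain U where "U \<in> carrier ?M" "X \<otimes>\<^bsub>?M\<^esub> ?\<Phi> = ?\<Phi> \<otimes>\<^bsub>?M\<^esub> U"
        using XZ by (auto simp: zelisko_group_def GL_def)
      ultimately show ?thesis
        using M.intertwine_mult[of X B U "S \<otimes>\<^bsub>?M\<^esub> T", OF XM BM _ _ diagonal_matrix_closed[of n \<phi>, OF \<phi>]]
        unfolding C_def by (auto intro!: bexI[of _ "U \<otimes>\<^bsub>?M\<^esub> (S \<otimes>\<^bsub>?M\<^esub> T)"])
    qed
    then have "\<phi> i divides C $$ (i, j) \<otimes> \<phi> j" if "i < n" "j < n" for i j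
      using intertwiner_exists_iff[of C n \<phi>, OF CM \<phi>] that by blast
    moreover have "C \<in> GL n R" unfolding GL_def C_eq using G by simp
    ultimately have CZ: "C \<in> zelisko_group R n ?\<Phi>"
      using Suc.IH[of C, OF less_imp_le[OF k]] Cid by simp
    let ?V' = "inv\<^bsub>?M\<^esub> V" and ?W' = "inv\<^bsub>?M\<^esub> W" and ?X' = "inv\<^bsub>?M\<^esub> X"
    note mem = HM VM WM XM CM M.Units_inv_closed[OF G(1)] M.Units_inv_closed[OF G(2)]
      M.Units_inv_closed[OF G(3)]
    have "?X' \<otimes>\<^bsub>?M\<^esub> C = ?X' \<otimes>\<^bsub>?M\<^esub> X \<otimes>\<^bsub>?M\<^esub> (H \<otimes>\<^bsub>?M\<^esub> V \<otimes>\<^bsub>?M\<^esub> W)"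
      unfolding C_eq using mem by (simp add: M.m_assoc)
    also have "\<dots> = H \<otimes>\<^bsub>?M\<^esub> V \<otimes>\<^bsub>?M\<^esub> W" using G(1) mem by simp
    finally have "?X' \<otimes>\<^bsub>?M\<^esub> C \<otimes>\<^bsub>?M\<^esub> ?W' \<otimes>\<^bsub>?M\<^esub> ?V' =
      H \<otimes>\<^bsub>?M\<^esub> V \<otimes>\<^bsub>?M\<^esub> (W \<otimes>\<^bsub>?M\<^esub> ?W') \<otimes>\<^bsub>?M\<^esub> ?V'"
      using mem by (simp add: M.m_assoc)
    also have "\<dots> = H \<otimes>\<^bsub>?M\<^esub> (V \<otimes>\<^bsub>?M\<^esub> ?V')" using G(3) mem by (simp add: M.m_assoc)
    also have "\<dots> = H" using G(2) mem by simp
    finally have "H = ?X' \<otimes>\<^bsub>?M\<^esub> C \<otimes>\<^bsub>?M\<^esub> ?W' \<otimes>\<^bsub>?M\<^esub> ?V'" by (rule sym)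
    also have "\<dots> \<in> zelisko_group R n ?\<Phi>"
      by (intro zelisko_group_mult[of n \<phi>, OF \<phi>] zelisko_group_inv[of n \<phi>, OF \<phi>] CZ XZ VZ WZ)
    finally show ?case .
  }
qed

end

section \<open>Quotients of Bezout domains\<close>

lemma bezout_domain_bezout_pairs:
  fixes R (structure)
  assumes "bezout_domain R"
  shows "bezout_pairs R"
  unfolding bezout_pairs_def
proof (intro ballI)
  interpret domain R using assms by (simp add: bezout_domain_def)
  fix a b assume ab[simp]: "a \<in> carrier R" "b \<in> carrier R"
  have "principalideal (Idl {a, b}) R" using assms by (auto simp: bezout_domain_def)
  then obtain g where g[simp]: "g \<in> carrier R" and "Idl {a, b} = Idl {g}"
    using principalideal.generate by blast
  then have I: "Idl {a, b} = PIdl g" by (simp add: cgenideal_eq_genideal)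
  have "{a, b} \<subseteq> PIdl g" unfolding I[symmetric] by (rule genideal_self) auto
  then obtain p q where pq: "p \<in> carrier R" "q \<in> carrier R" "a = p \<otimes> g" "b = q \<otimes> g"
    by (auto simp: cgenideal_def)
  have "{a, b} \<subseteq> PIdl a <+> PIdl b"
  proof -
    have z: "\<zero> \<in> PIdl c" if "c \<in> carrier R" for c
      using additive_subgroup.zero_closed[OF ideal.axioms(1)[OF cgenideal_ideal[OF that]]] .
    have "a \<oplus> \<zero> \<in> PIdl a <+> PIdl b" "\<zero> \<oplus> b \<in> PIdl a <+> PIdl b"
      unfolding set_add_def' using z cgenideal_self ab by blast+
    then show ?thesis by simp
  qed
  then have "Idl {a, b} \<subseteq> PIdl a <+> PIdl b"
    by (intro genideal_minimal add_ideals cgenideal_ideal ab)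
  moreover have "g \<in> Idl {a, b}" unfolding I by (rule cgenideal_self) simp
  ultimately obtain \<alpha> \<beta> where "\<alpha> \<in> carrier R" "\<beta> \<in> carrier R" "g = \<alpha> \<otimes> a \<oplus> \<beta> \<otimes> b"
    by (auto simp: set_add_def' cgenideal_def)
  with pq show "\<exists>g\<in>carrier R. \<exists>p\<in>carrier R. \<exists>q\<in>carrier R. \<exists>\<alpha>\<in>carrier R. \<exists>\<beta>\<in>carrier R.
      a = g \<otimes> p \<and> b = g \<otimes> q \<and> g = a \<otimes> \<alpha> \<oplus> b \<otimes> \<beta>"
    using g ab by (metis m_comm)
qed

lemma (in cring) coprime_bezout:
  assumes "bezout_pairs R" and ac: "a \<in> carrier R" "c \<in> carrier R" and "is_gcd R \<one> {a, c}"
  obtains x y where "x \<in> carrier R" "y \<in> carrier R" "a \<otimes> x \<oplus> c \<otimes> y = \<one>"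
proof -
  obtain g p q \<alpha> \<beta> where c: "g \<in> carrier R" "p \<in> carrier R" "q \<in> carrier R"
    "\<alpha> \<in> carrier R" "\<beta> \<in> carrier R" and gpq: "a = g \<otimes> p" "c = g \<otimes> q"
    and g: "g = a \<otimes> \<alpha> \<oplus> c \<otimes> \<beta>"
    by (rule bezout_pairsE[OF assms(1) ac])
  have "g divides a" "g divides c" using gpq c(2,3) unfolding factor_def by blast+
  then have "g divides \<one>" using assms(4) c by (auto simp: is_gcd_def)
  then obtain z where z: "z \<in> carrier R" and one: "\<one> = g \<otimes> z" by (auto simp: factor_def)
  have "a \<otimes> (\<alpha> \<otimes> z) \<oplus> c \<otimes> (\<beta> \<otimes> z) = (a \<otimes> \<alpha> \<oplus> c \<otimes> \<beta>) \<otimes> z"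
    using c ac z by algebra
  also have "\<dots> = \<one>" by (simp only: g[symmetric] one[symmetric])
  finally show thesis using c z by (intro that) auto
qed

context ring_hom_cring
begin

text \<open>
  A relation \<open>a x + b y = 1\<close> in the image lifts to one modulo \<open>m\<close>, which makes \<open>a\<close>, \<open>b\<close> and \<open>m\<close>
  coprime; stable range 1.5 with third element \<open>m\<close> then yields an element coprime to \<open>m\<close>, and such
  elements become units.
\<close>
lemma image_stable_range_one:
  assumes bez: "bezout_pairs R" and sr: "stable_range_one_half R"
    and m[simp]: "m \<in> carrier R" and m0: "m \<noteq> \<zero>"
    and surj: "h ` carrier R = carrier S"
    and ker: "\<And>x. x \<in> carrier R \<Longrightarrow> h x = \<zero>\<^bsub>S\<^esub> \<longleftrightarrow> m divides x"
  shows "stable_range_one S"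
  unfolding stable_range_one_def
proof (intro ballI impI)
  fix a b x y
  assume "a \<in> carrier S" "b \<in> carrier S" "x \<in> carrier S" "y \<in> carrier S"
  then have "a \<in> h ` carrier R" "b \<in> h ` carrier R" "x \<in> h ` carrier R" "y \<in> h ` carrier R"
    by (simp_all only: surj)
  then obtain a' b' x' y' where c[simp]: "a' \<in> carrier R" "b' \<in> carrier R" "x' \<in> carrier R" "y' \<in> carrier R"
    and h: "a = h a'" "b = h b'" "x = h x'" "y = h y'"
    by (elim imageE) (rule that)
  assume "a \<otimes>\<^bsub>S\<^esub> x \<oplus>\<^bsub>S\<^esub> b \<otimes>\<^bsub>S\<^esub> y = \<one>\<^bsub>S\<^esub>"
  then have "h (a' \<otimes> x' \<oplus> b' \<otimes> y' \<ominus> \<one>) = \<zero>\<^bsub>S\<^esub>"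
    by (simp add: h a_minus_def S.r_neg)
  moreover have "a' \<otimes> x' \<oplus> b' \<otimes> y' \<ominus> \<one> \<in> carrier R" by simp
  ultimately have "m divides (a' \<otimes> x' \<oplus> b' \<otimes> y' \<ominus> \<one>)" using ker by blast
  then obtain z where z[simp]: "z \<in> carrier R" and mz: "a' \<otimes> x' \<oplus> b' \<otimes> y' \<ominus> \<one> = m \<otimes> z"
    by (auto simp: factor_def)
  have "is_gcd R \<one> {a', b', m}"
    unfolding is_gcd_def
  proof (intro conjI ballI impI)
    fix d assume d: "d \<in> carrier R" and "\<forall>e\<in>{a', b', m}. d divides e"
    then have "d divides a'" "d divides b'" "d divides m" by simp_all
    then obtain a1 b1 m1 where c1: "a1 \<in> carrier R" "b1 \<in> carrier R" "m1 \<in> carrier R"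
      and d1: "a' = d \<otimes> a1" "b' = d \<otimes> b1" "m = d \<otimes> m1"
      unfolding factor_def by (elim bexE) (rule that)
    have "\<one> = a' \<otimes> x' \<oplus> b' \<otimes> y' \<ominus> (a' \<otimes> x' \<oplus> b' \<otimes> y' \<ominus> \<one>)"
      using c by algebra
    also have "\<dots> = d \<otimes> (a1 \<otimes> x' \<oplus> b1 \<otimes> y' \<ominus> m1 \<otimes> z)"
      unfolding mz unfolding d1 using d c1 c(3,4) z by algebra
    finally show "d divides \<one>"
      using c1 by (intro dividesI[of "a1 \<otimes> x' \<oplus> b1 \<otimes> y' \<ominus> m1 \<otimes> z"]) auto
  qed (auto simp: factor_def)
  moreover have "m \<in> carrier R - {\<zero>}" using m m0 by simp
  ultimately obtain r where r[simp]: "r \<in> carrier R" and gcd: "is_gcd R \<one> {a' \<oplus> b' \<otimes> r, m}"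
    using bspec[OF bspec[OF bspec[OF sr[unfolded stable_range_one_half_def] c(1)] c(2)]] by blast
  have [simp]: "a' \<oplus> b' \<otimes> r \<in> carrier R" by simp
  obtain s t where st[simp]: "s \<in> carrier R" "t \<in> carrier R"
    and "(a' \<oplus> b' \<otimes> r) \<otimes> s \<oplus> m \<otimes> t = \<one>"
    by (rule R.coprime_bezout[OF bez _ m gcd]) simp_all
  then have "h ((a' \<oplus> b' \<otimes> r) \<otimes> s \<oplus> m \<otimes> t) = \<one>\<^bsub>S\<^esub>" by simp
  moreover have "h m = \<zero>\<^bsub>S\<^esub>" using ker[OF m] by simp
  ultimately have "(a \<oplus>\<^bsub>S\<^esub> b \<otimes>\<^bsub>S\<^esub> h r) \<otimes>\<^bsub>S\<^esub> h s = \<one>\<^bsub>S\<^esub>" by (simp add: h)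
  then have "a \<oplus>\<^bsub>S\<^esub> b \<otimes>\<^bsub>S\<^esub> h r \<in> Units S"
    unfolding Units_def by (auto simp: h S.m_comm intro!: bexI[of _ "h s"])
  then show "\<exists>r\<in>carrier S. a \<oplus>\<^bsub>S\<^esub> b \<otimes>\<^bsub>S\<^esub> r \<in> Units S" by (auto intro!: bexI[of _ "h r"])
qed

lemma image_bezout_pairs:
  assumes bez: "bezout_pairs R" and surj: "h ` carrier R = carrier S"
  shows "bezout_pairs S"
  unfolding bezout_pairs_def
proof (intro ballI)
  fix a b
  assume "a \<in> carrier S" "b \<in> carrier S"
  then obtain a' b' where c: "a' \<in> carrier R" "b' \<in> carrier R" and h: "a = h a'" "b = h b'"
    using surj by (metis (no_types, lifting) imageE)
  obtain g p q \<alpha> \<beta> where c': "g \<in> carrier R" "p \<in> carrier R" "q \<in> carrier R"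
    "\<alpha> \<in> carrier R" "\<beta> \<in> carrier R" and gpq: "a' = g \<otimes> p" "b' = g \<otimes> q"
    and g: "g = a' \<otimes> \<alpha> \<oplus> b' \<otimes> \<beta>"
    by (rule bezout_pairsE[OF bez c])
  have "h g = h (a' \<otimes> \<alpha> \<oplus> b' \<otimes> \<beta>)" using g by (rule arg_cong)
  also have "\<dots> = a \<otimes>\<^bsub>S\<^esub> h \<alpha> \<oplus>\<^bsub>S\<^esub> b \<otimes>\<^bsub>S\<^esub> h \<beta>" using c c' by (simp add: h)
  finally have eqs: "h g = a \<otimes>\<^bsub>S\<^esub> h \<alpha> \<oplus>\<^bsub>S\<^esub> b \<otimes>\<^bsub>S\<^esub> h \<beta>"
    "a = h g \<otimes>\<^bsub>S\<^esub> h p" "b = h g \<otimes>\<^bsub>S\<^esub> h q"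
    unfolding h gpq using c' by simp_all
  show "\<exists>g\<in>carrier S. \<exists>p\<in>carrier S. \<exists>q\<in>carrier S. \<exists>\<alpha>\<in>carrier S. \<exists>\<beta>\<in>carrier S.
      a = g \<otimes>\<^bsub>S\<^esub> p \<and> b = g \<otimes>\<^bsub>S\<^esub> q \<and> g = a \<otimes>\<^bsub>S\<^esub> \<alpha> \<oplus>\<^bsub>S\<^esub> b \<otimes>\<^bsub>S\<^esub> \<beta>"
    by (intro bexI[of _ "h g"] bexI[of _ "h p"] bexI[of _ "h q"] bexI[of _ "h \<alpha>"] bexI[of _ "h \<beta>"]
        conjI eqs hom_closed c')
qed

text \<open>
  If \<open>d\<close> is a greatest common divisor of \<open>a\<close> and \<open>m\<close>, the annihilator of the image of \<open>a\<close> is generated by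
  the image of \<open>m / d\<close>: from \<open>a x = m y\<close> one may cancel \<open>d\<close>, and \<open>a / d\<close> is invertible modulo
  \<open>m / d\<close>.
\<close>
lemma image_principal_annihilators:
  assumes "domain R" and bez: "bezout_pairs R"
    and m[simp]: "m \<in> carrier R" and m0: "m \<noteq> \<zero>"
    and surj: "h ` carrier R = carrier S"
    and ker: "\<And>x. x \<in> carrier R \<Longrightarrow> h x = \<zero>\<^bsub>S\<^esub> \<longleftrightarrow> m divides x"
  shows "principal_annihilators S"
  unfolding principal_annihilators_def
proof (intro ballI)
  interpret domain R by fact
  fix a assume "a \<in> carrier S"
  then obtain a' where a'[simp]: "a' \<in> carrier R" and a: "a = h a'" using surj by auto
  obtain d a1 m1 \<alpha> \<beta> where c[simp]: "d \<in> carrier R" "a1 \<in> carrier R" "m1 \<in> carrier R"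
    "\<alpha> \<in> carrier R" "\<beta> \<in> carrier R" and d: "a' = d \<otimes> a1" "m = d \<otimes> m1"
    and dl: "d = a' \<otimes> \<alpha> \<oplus> m \<otimes> \<beta>"
    by (rule bezout_pairsE[OF bez a' m])
  have d0: "d \<noteq> \<zero>" using m0 d(2) by auto
  have "d \<otimes> (a1 \<otimes> \<alpha> \<oplus> m1 \<otimes> \<beta>) = a' \<otimes> \<alpha> \<oplus> m \<otimes> \<beta>"
    unfolding d using c by algebra
  also have "\<dots> = d \<otimes> \<one>" using dl by simp
  finally have one: "a1 \<otimes> \<alpha> \<oplus> m1 \<otimes> \<beta> = \<one>"
    using d0 by (subst (asm) m_lcancel) auto
  have "a \<otimes>\<^bsub>S\<^esub> x = \<zero>\<^bsub>S\<^esub> \<longleftrightarrow> h m1 divides\<^bsub>S\<^esub> x" if x: "x \<in> carrier S" for x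
  proof
    assume ax: "a \<otimes>\<^bsub>S\<^esub> x = \<zero>\<^bsub>S\<^esub>"
    obtain x' where x'[simp]: "x' \<in> carrier R" and hx: "x = h x'" using surj x by auto
    have "h (a' \<otimes> x') = \<zero>\<^bsub>S\<^esub>" using ax by (simp add: a hx)
    then have "m divides (a' \<otimes> x')" using ker[of "a' \<otimes> x'"] a' x' by (simp only: R.m_closed)
    then obtain y where y[simp]: "y \<in> carrier R" and "a' \<otimes> x' = m \<otimes> y"
      by (auto simp: factor_def)
    then have "d \<otimes> (a1 \<otimes> x') = d \<otimes> (m1 \<otimes> y)" by (simp add: d R.m_assoc)
    then have ay: "a1 \<otimes> x' = m1 \<otimes> y" using d0 by (subst (asm) m_lcancel) auto
    have "x' = (a1 \<otimes> \<alpha> \<oplus> m1 \<otimes> \<beta>) \<otimes> x'" unfolding one by simp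
    also have "\<dots> = a1 \<otimes> x' \<otimes> \<alpha> \<oplus> m1 \<otimes> \<beta> \<otimes> x'" using c x' by algebra
    also have "\<dots> = m1 \<otimes> (y \<otimes> \<alpha> \<oplus> \<beta> \<otimes> x')" unfolding ay using c x' y by algebra
    finally have "h x' = h (m1 \<otimes> (y \<otimes> \<alpha> \<oplus> \<beta> \<otimes> x'))" by simp
    then have "x = h m1 \<otimes>\<^bsub>S\<^esub> h (y \<otimes> \<alpha> \<oplus> \<beta> \<otimes> x')" unfolding hx by (subst (asm) hom_mult) auto
    then show "h m1 divides\<^bsub>S\<^esub> x" by (intro dividesI[of "h (y \<otimes> \<alpha> \<oplus> \<beta> \<otimes> x')"]) auto
  next
    assume "h m1 divides\<^bsub>S\<^esub> x"
    then obtain z where z[simp]: "z \<in> carrier S" and xz: "x = h m1 \<otimes>\<^bsub>S\<^esub> z" by (auto simp: factor_def)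
    have "a' \<otimes> m1 = m \<otimes> a1" unfolding d using c by algebra
    then have "h (a' \<otimes> m1) = \<zero>\<^bsub>S\<^esub>" using ker[of "a' \<otimes> m1"] by (auto intro!: dividesI[of a1])
    then have "a \<otimes>\<^bsub>S\<^esub> h m1 = \<zero>\<^bsub>S\<^esub>" by (simp add: a)
    then show "a \<otimes>\<^bsub>S\<^esub> x = \<zero>\<^bsub>S\<^esub>"
      unfolding xz by (simp add: S.m_assoc[symmetric] a)
  qed
  then show "\<exists>k\<in>carrier S. \<forall>x\<in>carrier S. a \<otimes>\<^bsub>S\<^esub> x = \<zero>\<^bsub>S\<^esub> \<longleftrightarrow> k divides\<^bsub>S\<^esub> x"
    by (intro bexI[of _ "h m1"]) auto
qed

end

lemma quot_mod_properties:
  fixes R (structure)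
  assumes bd: "bezout_domain R" and sr: "stable_range_one_half R"
    and m[simp]: "m \<in> carrier R" and m0: "m \<noteq> \<zero>"
  shows "cring (quot_mod R m)" "stable_range_one (quot_mod R m)" "bezout_pairs (quot_mod R m)"
    "principal_annihilators (quot_mod R m)"
proof -
  interpret domain R using bd by (simp add: bezout_domain_def)
  interpret I: ideal "PIdl m" R by (rule cgenideal_ideal) simp
  let ?h = "\<lambda>x. PIdl m +> x"
  have hom: "ring_hom_cring R (quot_mod R m) ?h"
    unfolding quot_mod_def by (rule I.rcos_ring_hom_cring) (rule is_cring)
  have surj: "?h ` carrier R = carrier (quot_mod R m)"
    by (auto simp: quot_mod_def FactRing_def A_RCOSETS_def')
  have ker: "PIdl m +> x = \<zero>\<^bsub>quot_mod R m\<^esub> \<longleftrightarrow> m divides x" if x: "x \<in> carrier R" for x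
  proof -
    have zero: "\<zero>\<^bsub>quot_mod R m\<^esub> = PIdl m" by (simp add: quot_mod_def FactRing_def)
    have "PIdl m +> x = PIdl m \<longleftrightarrow> x \<in> PIdl m"
    proof
      assume "PIdl m +> x = PIdl m"
      then show "x \<in> PIdl m" using I.a_rcos_self[OF x] by simp
    next
      assume "x \<in> PIdl m"
      then show "PIdl m +> x = PIdl m" by (rule I.a_rcos_const)
    qed
    also have "\<dots> \<longleftrightarrow> (\<exists>c\<in>carrier R. x = c \<otimes> m)" unfolding cgenideal_def by blast
    also have "\<dots> \<longleftrightarrow> m divides x"
      unfolding factor_def by (intro bex_cong refl) (simp add: m_comm)
    finally show ?thesis unfolding zero .
  qed
  note bez = bezout_domain_bezout_pairs[OF bd]
  show "cring (quot_mod R m)" by (rule ring_hom_cring.axioms(2)[OF hom])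
  show "stable_range_one (quot_mod R m)"
    by (rule ring_hom_cring.image_stable_range_one[OF hom bez sr m m0 surj ker])
  show "bezout_pairs (quot_mod R m)"
    by (rule ring_hom_cring.image_bezout_pairs[OF hom bez surj])
  show "principal_annihilators (quot_mod R m)"
    by (rule ring_hom_cring.image_principal_annihilators[OF hom domain_axioms bez m m0 surj ker])
qed

theorem theorem2:
  fixes R :: "('a, 'b) ring_scheme" and m :: 'a and n :: nat
    and \<phi> :: "nat \<Rightarrow> 'a set" and ord :: "'a set rel"
  assumes "bezout_domain R"
    and "stable_range_one_half R"
    and "m \<in> carrier R" and "m \<noteq> \<zero>\<^bsub>R\<^esub>" and "m \<notin> Units R"
    and "admissible_order (quot_mod R m) ord"
    and "n \<ge> 2"
    and "\<forall>i<n. \<phi> i \<in> carrier (quot_mod R m)"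
    and "\<forall>i. Suc i < n \<longrightarrow> \<phi> i divides\<^bsub>quot_mod R m\<^esub> \<phi> (Suc i)"
    and "\<phi> (n - 1) \<noteq> \<zero>\<^bsub>quot_mod R m\<^esub>"
  shows "zelisko_group (quot_mod R m) n (diagonal_matrix (quot_mod R m) n \<phi>) =
    {H \<in> GL n (quot_mod R m).
      \<exists>h :: nat \<Rightarrow> nat \<Rightarrow> 'a set.
        (\<forall>i<n. \<forall>j<n. h i j \<in> carrier (quot_mod R m)) \<and>
        H = mat n n (\<lambda>(i, j).
          if j < i
          then min_generating_solution (quot_mod R m) ord (\<phi> i) (\<phi> j) \<otimes>\<^bsub>quot_mod R m\<^esub> h i j
          else h i j)}"
    (is "?Z = {H \<in> ?GL. ?form H}")
proof -
  let ?Q = "quot_mod R m"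
  note Q = quot_mod_properties[OF assms(1-4)]
  interpret Q: cring ?Q by (rule Q(1))
  have \<phi>: "\<And>i. i < n \<Longrightarrow> \<phi> i \<in> carrier ?Q" using assms(8) by simp
  have dvd: "\<phi> i divides\<^bsub>?Q\<^esub> \<phi> j" if "i \<le> j" "j < n" for i j
    using Q.divides_chain[of n \<phi>, OF \<phi> _ that] assms(9) by simp
  define t where "t i j = min_generating_solution ?Q ord (\<phi> i) (\<phi> j)" for i j
  have t: "t i j \<in> generating_solutions ?Q (\<phi> i) (\<phi> j)" if "j < i" "i < n" for i j
    unfolding t_def using that \<phi> dvd[of j i] Q.generating_solutions_nonempty[OF Q(2-4)]
    by (intro min_generating_solution_in[OF assms(6)]) auto
  have tc: "t i j \<in> carrier ?Q" if "j < i" "i < n" for i j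
    using t[OF that] by (auto simp: generating_solutions_def)
  have tdiv: "t i j divides\<^bsub>?Q\<^esub> h \<longleftrightarrow> \<phi> i divides\<^bsub>?Q\<^esub> h \<otimes>\<^bsub>?Q\<^esub> \<phi> j"
    if "j < i" "i < n" "h \<in> carrier ?Q" for i j h
    using Q.generating_solution_divides_iff[OF t[OF that(1,2)] \<phi> that(3)] that by simp
  have upper: "\<phi> i divides\<^bsub>?Q\<^esub> h \<otimes>\<^bsub>?Q\<^esub> \<phi> j" if "i \<le> j" "j < n" "h \<in> carrier ?Q" for i j h
    using dvd[OF that(1,2)] that \<phi> by (intro Q.divides_prod_l) auto
  have "H \<in> ?Z \<longleftrightarrow> ?form H" if H: "H \<in> ?GL" for H
  proof -
    have HM: "H \<in> carrier (mat_monoid ?Q n)" using H by (auto simp: GL_def Units_def)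
    note Hc = mat_monoid_carrierD[OF HM]
    let ?div = "\<forall>i<n. \<forall>j<n. \<phi> i divides\<^bsub>?Q\<^esub> H $$ (i, j) \<otimes>\<^bsub>?Q\<^esub> \<phi> j"
    have "H \<in> ?Z \<longleftrightarrow> ?div"
    proof
      assume "H \<in> ?Z"
      then obtain S where "S \<in> carrier (mat_monoid ?Q n)"
        "H \<otimes>\<^bsub>mat_monoid ?Q n\<^esub> diagonal_matrix ?Q n \<phi> =
          diagonal_matrix ?Q n \<phi> \<otimes>\<^bsub>mat_monoid ?Q n\<^esub> S"
        by (auto simp: zelisko_group_def GL_def Units_def)
      then show ?div
        using Q.intertwiner_exists_iff[of H n \<phi>, OF HM \<phi>] by blast
    next
      assume ?div
      then show "H \<in> ?Z"
        using Q.invertible_intertwiner_in_zelisko_group[of n \<phi> n H, OF Q(2) \<phi> dvd le_refl H] by simp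
    qed
    also have "?div \<longleftrightarrow> (\<forall>i<n. \<forall>j<n. j < i \<longrightarrow> t i j divides\<^bsub>?Q\<^esub> H $$ (i, j))"
    proof (intro iffI allI impI)
      fix i j assume "?div" and ij: "i < n" "j < n" "j < i"
      then show "t i j divides\<^bsub>?Q\<^esub> H $$ (i, j)" using tdiv[OF ij(3,1) Hc(3)[OF ij(1,2)]] by simp
    next
      fix i j assume t: "\<forall>i<n. \<forall>j<n. j < i \<longrightarrow> t i j divides\<^bsub>?Q\<^esub> H $$ (i, j)"
        and ij: "i < n" "j < n"
      show "\<phi> i divides\<^bsub>?Q\<^esub> H $$ (i, j) \<otimes>\<^bsub>?Q\<^esub> \<phi> j"
      proof (cases "j < i")
        case True
        then show ?thesis using t ij tdiv[OF True ij(1) Hc(3)[OF ij]] by simp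
      next
        case False
        then show ?thesis using upper[OF _ ij(2) Hc(3)[OF ij]] by simp
      qed
    qed
    also have "\<dots> \<longleftrightarrow> ?form H"
    proof
      assume t: "\<forall>i<n. \<forall>j<n. j < i \<longrightarrow> t i j divides\<^bsub>?Q\<^esub> H $$ (i, j)"
      have "\<forall>i j. \<exists>s. i < n \<longrightarrow> j < n \<longrightarrow> s \<in> carrier ?Q \<and>
          H $$ (i, j) = (if j < i then t i j \<otimes>\<^bsub>?Q\<^esub> s else s)" (is "\<forall>i j. \<exists>s. ?P i j s")
      proof (intro allI)
        fix i j
        show "\<exists>s. ?P i j s"
        proof (cases "i < n \<and> j < i")
          case True
          then have "j < n" by simp
          with t True have "t i j divides\<^bsub>?Q\<^esub> H $$ (i, j)" by blast
          then show ?thesis using True by (auto simp: factor_def)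
        next
          case False
          then show ?thesis using Hc(3)[of i j] by auto
        qed
      qed
      then obtain h where "\<forall>i j. ?P i j (h i j)"
        unfolding choice_iff by (elim exE) (rule that)
      then show "?form H"
        using Hc(1,2) unfolding t_def by (intro exI[of _ h]) (auto intro!: eq_matI)
    next
      assume "?form H"
      then obtain h where h: "\<forall>i<n. \<forall>j<n. h i j \<in> carrier ?Q"
        and "H = mat n n (\<lambda>(i, j). if j < i then t i j \<otimes>\<^bsub>?Q\<^esub> h i j else h i j)"
        unfolding t_def by blast
      then show "\<forall>i<n. \<forall>j<n. j < i \<longrightarrow> t i j divides\<^bsub>?Q\<^esub> H $$ (i, j)"
        using tc by (auto simp: factor_def)
    qed
    finally show ?thesis .
  qed
  moreover have "?Z \<subseteq> ?GL" by (auto simp: zelisko_group_def)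
  ultimately show ?thesis by blast
qed

end
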